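(* Fix $\varepsilon\in(1/2,1)$ and $\alpha\in\mathbb{N}$. For $f\in\mathscr{H}_\alpha$ and every integer $n\geq 2$, with $T=\sqrt{\frac{2}{1-\varepsilon}\alpha\ln(n)}$, \[ |I(f)-Q_{n,T}^*(f\rho)|\leq C\|f\|_\alpha\frac{(\ln n)^{\alpha/2+1/4}}{n^\alpha}, \] where the constant $C$ is independent of $n$ and $f$ but depends on $\alpha$ and $\varepsilon$.
   Context: Let $\rho(x)=\frac{1}{\sqrt{2\pi}}\mathrm{e}^{-x^2/2}$ and $L^2_\rho$ the space of (equivalence classes of) measurable $f:\mathbb{R}\to\mathbb{R}$ with $\|f\|_{L^2_\rho}^2=\int_\mathbb{R}|f(x)|^2\rho(x)\,\mathrm{d}x<\infty$. For $\alpha\in\mathbb{N}$, the weighted Sobolev space $\mathscr{H}_\alpha$ is the set of $f\in L^2_\rho$ having weak derivatives $f^{(\tau)}\in L^2_\rho$ for $\tau=1,\dots,\alpha$, with norm $\|f\|_\alpha=(\sum_{\tau=0}^\alpha\|f^{(\tau)}\|_{L^2_\rho}^2)^{1/2}$; elements are identified with their continuous representatives. Let $I(f)=\int_\mathbb{R}f(x)\rho(x)\,\mathrm{d}x$. For $T>0$ and $n\in\mathbb{N}$, the trapezoidal rule is $Q_{n,T}^*(g)=\frac{2T}{n}\sum_{j=0}^{n-1}g(\xi_j^* )$ with $\xi_j^*=\frac{2T}{n}j-T$, $j=0,\dots,n-1$; here it is applied to $g=f\rho$. *)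

theory Defs
  imports "HOL-Analysis.Analysis"
begin

definition gauss_rho :: "real \<Rightarrow> real" where
  "gauss_rho x = exp (- (x^2) / 2) / sqrt (2 * pi)"

definition in_L2rho :: "(real \<Rightarrow> real) \<Rightarrow> bool" where
  "in_L2rho f \<longleftrightarrow> f \<in> borel_measurable borel \<and>
     integrable lborel (\<lambda>x. (f x)^2 * gauss_rho x)"

definition L2rho_norm :: "(real \<Rightarrow> real) \<Rightarrow> real" where
  "L2rho_norm f = sqrt (integral\<^sup>L lborel (\<lambda>x. (f x)^2 * gauss_rho x))"

definition test_fun :: "(real \<Rightarrow> real) \<Rightarrow> bool" where
  "test_fun \<phi> \<longleftrightarrow> (\<forall>k x. ((deriv ^^ k) \<phi>) differentiable (at x)) \<and>
     (\<exists>R. \<forall>x. \<bar>x\<bar> > R \<longrightarrow> \<phi> x = 0)"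

definition weak_deriv :: "nat \<Rightarrow> (real \<Rightarrow> real) \<Rightarrow> (real \<Rightarrow> real) \<Rightarrow> bool" where
  "weak_deriv \<tau> f g \<longleftrightarrow> (\<forall>\<phi>. test_fun \<phi> \<longrightarrow>
      integrable lborel (\<lambda>x. f x * (deriv ^^ \<tau>) \<phi> x) \<and>
      integrable lborel (\<lambda>x. g x * \<phi> x) \<and>
      integral\<^sup>L lborel (\<lambda>x. f x * (deriv ^^ \<tau>) \<phi> x)
        = (-1) ^ \<tau> * integral\<^sup>L lborel (\<lambda>x. g x * \<phi> x))"

definition sobolev_H :: "nat \<Rightarrow> (real \<Rightarrow> real) \<Rightarrow> (nat \<Rightarrow> real \<Rightarrow> real) \<Rightarrow> bool" where
  "sobolev_H \<alpha> f g \<longleftrightarrow> g 0 = f \<and> (\<forall>\<tau>\<le>\<alpha>. in_L2rho (g \<tau>)) \<and>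
     (\<forall>\<tau>\<in>{1..\<alpha>}. weak_deriv \<tau> f (g \<tau>))"

text \<open>The Sobolev norm ||f||_alpha, computed from the weak derivatives g.\<close>
definition sobolev_norm :: "nat \<Rightarrow> (nat \<Rightarrow> real \<Rightarrow> real) \<Rightarrow> real" where
  "sobolev_norm \<alpha> g = sqrt (\<Sum>\<tau>\<le>\<alpha>. (L2rho_norm (g \<tau>))^2)"

definition gauss_int :: "(real \<Rightarrow> real) \<Rightarrow> real" where
  "gauss_int f = integral\<^sup>L lborel (\<lambda>x. f x * gauss_rho x)"

definition trap_rule :: "nat \<Rightarrow> real \<Rightarrow> (real \<Rightarrow> real) \<Rightarrow> real" where
  "trap_rule n T g = 2 * T / real n * (\<Sum>j<n. g (2 * T / real n * real j - T))"

end

theory Submission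
  imports Defs "HOL-Probability.Distributions"
begin

text \<open>
  Let \<open>h = 2T/n\<close> and \<open>\<psi> = \<rho> \<chi>\<close> with a smooth cutoff \<open>\<chi>\<close> that is 1 on \<open>[-T, T-h]\<close> and 0 outside
  \<open>[-T-h/2, T-h/2]\<close>, so that the trapezoidal rule for \<open>f \<rho>\<close> is the sum of \<open>h f \<psi>\<close> over all nodes of
  \<open>-T + h\<int>\<close>. Integrating a smooth approximation of \<open>1 - h \<Sum>\<^sub>j \<delta>(x - \<xi>\<^sub>j)\<close> \<open>\<alpha>\<close> times, each time with
  the periodic mean-zero primitive, gives a smooth \<open>\<phi>\<close> with \<open>\<bar>\<phi>\<bar> \<le> 2 h\<^sup>\<alpha>\<close>. Moving the \<open>\<alpha>\<close>
  derivatives of \<open>\<phi>\<close> onto \<open>f \<psi>\<close>, which takes only the definition of weak derivatives, bounds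
  \<open>\<integral> f \<psi> - h \<Sum>\<^sub>j (f \<psi>)(\<xi>\<^sub>j)\<close> by \<open>h\<^sup>\<alpha>\<close> times the size of the derivatives of \<open>\<psi>\<close>.

  The derivatives of \<open>\<chi>\<close> are as large as \<open>h\<^bsup>-\<alpha>\<^esup>\<close>, but they are supported where \<open>\<bar>x\<bar> \<ge> T - h\<close>. As
  \<open>\<epsilon> > 1/2\<close>, the Gaussian leaves room there to split off \<open>exp (-(1-\<epsilon>) (T-h)\<^sup>2 / 2)\<close>, which is
  of order \<open>n\<^bsup>-\<alpha>\<^esup>\<close>, and to keep a factor \<open>exp (-\<beta> x\<^sup>2 / 2)\<close> with \<open>\<beta> > 1/2\<close> for the
  Cauchy-Schwarz inequality against \<open>L\<^sup>2\<^sub>\<rho>\<close>.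
\<close>

subsection \<open>Smooth functions\<close>

definition smooth_fun :: "(real \<Rightarrow> real) \<Rightarrow> bool" where
  "smooth_fun u \<longleftrightarrow> (\<forall>k x. ((deriv ^^ k) u) differentiable (at x))"

lemma higher_deriv_in_deriv_closed:
  fixes u :: "'a::real_normed_field \<Rightarrow> 'a"
  assumes "u \<in> S"
    and "\<And>v. v \<in> S \<Longrightarrow> \<exists>w\<in>S. \<forall>x. (v has_field_derivative w x) (at x)"
  shows "(deriv ^^ k) u \<in> S"
proof (induction k)
  case (Suc k)
  then obtain w where "w \<in> S" and w: "\<And>x. ((deriv ^^ k) u has_field_derivative w x) (at x)"
    using assms(2) by blast
  moreover have "deriv ((deriv ^^ k) u) = w"
    by (rule ext) (rule DERIV_imp_deriv[OF w])
  ultimately show ?case by simp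
qed (use assms(1) in simp)

lemma smooth_funI_deriv_closed:
  assumes "u \<in> S"
    and "\<And>v. v \<in> S \<Longrightarrow> \<exists>w\<in>S. \<forall>x. (v has_real_derivative w x) (at x)"
  shows "smooth_fun u"
  unfolding smooth_fun_def
  using assms(2)[OF higher_deriv_in_deriv_closed[OF assms]] real_differentiable_def by blast

lemma higher_deriv_deriv: "(deriv ^^ k) (deriv u) = (deriv ^^ Suc k) u"
  by (simp only: funpow_Suc_right o_apply)

lemma smooth_fun_deriv: "smooth_fun u \<Longrightarrow> smooth_fun (deriv u)"
  unfolding smooth_fun_def higher_deriv_deriv by blast

lemma smooth_fun_higher_deriv: "smooth_fun u \<Longrightarrow> smooth_fun ((deriv ^^ k) u)"
  by (induction k) (auto intro: smooth_fun_deriv)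

lemma smooth_fun_DERIV: "smooth_fun u \<Longrightarrow> (u has_real_derivative deriv u x) (at x)"
  unfolding DERIV_deriv_iff_real_differentiable smooth_fun_def by (drule spec[of _ 0]) simp

lemma smooth_fun_continuous_on: "smooth_fun u \<Longrightarrow> continuous_on A u"
  by (meson smooth_fun_DERIV DERIV_isCont continuous_at_imp_continuous_on)

lemma smooth_fun_borel_measurable: "smooth_fun u \<Longrightarrow> u \<in> borel_measurable borel"
  using smooth_fun_continuous_on borel_measurable_continuous_onI by blast

lemma smooth_fun_antiderivative:
  assumes "smooth_fun v" and "\<And>x. (u has_real_derivative v x) (at x)"
  shows "smooth_fun u"
proof (rule smooth_funI_deriv_closed[where S = "insert u (Collect smooth_fun)"])
  fix w assume "w \<in> insert u (Collect smooth_fun)"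
  then consider (antiderivative) "w = u" | (smooth) "smooth_fun w" by blast
  then show "\<exists>w'\<in>insert u (Collect smooth_fun). \<forall>x. (w has_real_derivative w' x) (at x)"
  proof cases
    case antiderivative
    then show ?thesis using assms by (intro bexI[of _ v]) auto
  next
    case smooth
    then show ?thesis
      by (intro bexI[of _ "deriv w"]) (auto intro: smooth_fun_deriv smooth_fun_DERIV)
  qed
qed simp

lemma smooth_fun_const [simp]: "smooth_fun (\<lambda>_. c)"
proof (rule smooth_funI_deriv_closed[where S = "range (\<lambda>c _. c)"])
  show "\<exists>w\<in>range (\<lambda>c _. c). \<forall>x. (v has_real_derivative w x) (at x)"
    if "v \<in> range (\<lambda>c _. c)" for v :: "real \<Rightarrow> real"
    using that by (auto intro!: exI[of _ 0])
qed simp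

lemma smooth_fun_ident [simp]: "smooth_fun (\<lambda>x. x)"
  by (rule smooth_fun_antiderivative[where v = "\<lambda>_. 1"]) auto

text \<open>
  This set contains a derivative of each of its elements, so \<open>smooth_funI_deriv_closed\<close> gives
  closure of smoothness under all four operations at once. A separate induction for the product
  would already need smoothness of the summands \<open>u' v\<close> and \<open>u v'\<close>.
\<close>
inductive_set smooth_closure :: "(real \<Rightarrow> real) set" where
  compose: "smooth_fun u \<Longrightarrow> smooth_fun v \<Longrightarrow> (\<lambda>x. u (v x)) \<in> smooth_closure"
| inverse: "smooth_fun u \<Longrightarrow> (\<And>x. u x \<noteq> 0) \<Longrightarrow> (\<lambda>x. inverse (u x)) \<in> smooth_closure"
| add: "u \<in> smooth_closure \<Longrightarrow> v \<in> smooth_closure \<Longrightarrow> (\<lambda>x. u x + v x) \<in> smooth_closure"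
| mult: "u \<in> smooth_closure \<Longrightarrow> v \<in> smooth_closure \<Longrightarrow> (\<lambda>x. u x * v x) \<in> smooth_closure"

lemma smooth_closureI: "smooth_fun u \<Longrightarrow> u \<in> smooth_closure"
  using smooth_closure.compose[OF _ smooth_fun_ident] by simp

lemma smooth_closure_deriv_closed:
  assumes "u \<in> smooth_closure"
  shows "\<exists>w\<in>smooth_closure. \<forall>x. (u has_real_derivative w x) (at x)"
  using assms
proof induction
  case (compose u v)
  have "(\<lambda>x. deriv u (v x) * deriv v x) \<in> smooth_closure"
    by (intro smooth_closure.mult smooth_closure.compose smooth_closureI smooth_fun_deriv compose)
  moreover have "((\<lambda>x. u (v x)) has_real_derivative deriv u (v x) * deriv v x) (at x)" for x
    using DERIV_chain2[OF smooth_fun_DERIV[OF compose(1)] smooth_fun_DERIV[OF compose(2)]] .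
  ultimately show ?case by (intro bexI allI)
next
  case (inverse u)
  have "(\<lambda>x. (- 1) * (inverse (u x) * deriv u x * inverse (u x))) \<in> smooth_closure"
    by (intro smooth_closure.mult smooth_closure.inverse)
      (use inverse in \<open>auto intro: smooth_closureI smooth_fun_deriv\<close>)
  moreover have "((\<lambda>x. inverse (u x)) has_real_derivative
      (- 1) * (inverse (u x) * deriv u x * inverse (u x))) (at x)" for x
    using DERIV_inverse'[OF smooth_fun_DERIV[OF inverse(1)] inverse(2)] by simp
  ultimately show ?case by (intro bexI allI)
next
  case (add u v)
  then obtain u' v' where "u' \<in> smooth_closure" "v' \<in> smooth_closure"
    and "\<And>x. (u has_real_derivative u' x) (at x)" "\<And>x. (v has_real_derivative v' x) (at x)"
    by blast
  then have "(\<lambda>x. u' x + v' x) \<in> smooth_closure"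
    and "((\<lambda>x. u x + v x) has_real_derivative u' x + v' x) (at x)" for x
    by (auto intro: smooth_closure.add DERIV_add)
  then show ?case by (intro bexI allI)
next
  case (mult u v)
  then obtain u' v' where deriv_closed: "u' \<in> smooth_closure" "v' \<in> smooth_closure"
    and "\<And>x. (u has_real_derivative u' x) (at x)" "\<And>x. (v has_real_derivative v' x) (at x)"
    by blast
  then have "((\<lambda>x. u x * v x) has_real_derivative u' x * v x + v' x * u x) (at x)" for x
    by (intro DERIV_mult)
  moreover have "(\<lambda>x. u' x * v x + v' x * u x) \<in> smooth_closure"
    by (intro smooth_closure.add smooth_closure.mult deriv_closed mult)
  ultimately show ?case by (intro bexI allI)
qed

lemma smooth_closure_imp_smooth_fun: "u \<in> smooth_closure \<Longrightarrow> smooth_fun u"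
  using smooth_funI_deriv_closed[OF _ smooth_closure_deriv_closed] .

lemma smooth_fun_compose: "smooth_fun u \<Longrightarrow> smooth_fun v \<Longrightarrow> smooth_fun (\<lambda>x. u (v x))"
  by (rule smooth_closure_imp_smooth_fun[OF smooth_closure.compose])

lemma smooth_fun_inverse: "smooth_fun u \<Longrightarrow> (\<And>x. u x \<noteq> 0) \<Longrightarrow> smooth_fun (\<lambda>x. inverse (u x))"
  by (rule smooth_closure_imp_smooth_fun[OF smooth_closure.inverse])

lemma smooth_fun_add: "smooth_fun u \<Longrightarrow> smooth_fun v \<Longrightarrow> smooth_fun (\<lambda>x. u x + v x)"
  by (intro smooth_closure_imp_smooth_fun smooth_closure.add) (simp_all add: smooth_closureI)

lemma smooth_fun_mult: "smooth_fun u \<Longrightarrow> smooth_fun v \<Longrightarrow> smooth_fun (\<lambda>x. u x * v x)"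
  by (intro smooth_closure_imp_smooth_fun smooth_closure.mult) (simp_all add: smooth_closureI)

lemma smooth_fun_diff:
  assumes "smooth_fun u" "smooth_fun v"
  shows "smooth_fun (\<lambda>x. u x - v x)"
  using smooth_fun_add[OF assms(1) smooth_fun_mult[OF smooth_fun_const assms(2)], of "- 1"] by simp

lemma smooth_fun_affine: "smooth_fun (\<lambda>x. a * x + b)"
  by (intro smooth_fun_add smooth_fun_mult) simp_all

lemma smooth_fun_cos: "smooth_fun cos"
proof (rule smooth_funI_deriv_closed)
  let ?trig = "\<lambda>(a, b) x. a * cos x + b * sin (x::real)"
  show "cos \<in> range ?trig" by (rule image_eqI[of _ _ "(1, 0)"]) auto
  fix v assume "v \<in> range ?trig"
  then obtain a b where v: "v = ?trig (a, b)" by auto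
  have "(v has_real_derivative ?trig (b, - a) x) (at x)" for x
    unfolding v by (auto intro!: derivative_eq_intros)
  then show "\<exists>w\<in>range ?trig. \<forall>x. (v has_real_derivative w x) (at x)"
    by (intro bexI[of _ "?trig (b, - a)"] allI rangeI)
qed

lemma deriv_mult_smooth_fun:
  assumes "smooth_fun u" "smooth_fun v"
  shows "deriv (\<lambda>x. u x * v x) = (\<lambda>x. deriv u x * v x + u x * deriv v x)"
  using DERIV_imp_deriv[OF DERIV_mult[OF assms[THEN smooth_fun_DERIV]]]
  by (simp add: fun_eq_iff mult_ac)

lemma higher_deriv_eqI:
  fixes D :: "nat \<Rightarrow> 'a::real_normed_field \<Rightarrow> 'a"
  assumes "\<And>k x. (D k has_field_derivative D (Suc k) x) (at x)"
  shows "(deriv ^^ k) (D 0) = D k"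
proof (induction k)
  case (Suc k)
  have "deriv (D k) = D (Suc k)" by (rule ext) (rule DERIV_imp_deriv[OF assms])
  with Suc show ?case by simp
qed simp

lemma smooth_fun_higher_DERIV:
  "smooth_fun u \<Longrightarrow> ((deriv ^^ k) u has_real_derivative (deriv ^^ Suc k) u x) (at x)"
  using smooth_fun_DERIV[OF smooth_fun_higher_deriv] by simp

lemma higher_deriv_add_smooth_fun:
  assumes "smooth_fun u" "smooth_fun v"
  shows "(deriv ^^ k) (\<lambda>x. u x + v x) = (\<lambda>x. (deriv ^^ k) u x + (deriv ^^ k) v x)"
  using higher_deriv_eqI[of "\<lambda>k x. (deriv ^^ k) u x + (deriv ^^ k) v x"]
    DERIV_add[OF smooth_fun_higher_DERIV[OF assms(1)] smooth_fun_higher_DERIV[OF assms(2)]]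
  by simp

lemma higher_deriv_diff_smooth_fun:
  assumes "smooth_fun u" "smooth_fun v"
  shows "(deriv ^^ k) (\<lambda>x. u x - v x) = (\<lambda>x. (deriv ^^ k) u x - (deriv ^^ k) v x)"
  using higher_deriv_eqI[of "\<lambda>k x. (deriv ^^ k) u x - (deriv ^^ k) v x"]
    DERIV_diff[OF smooth_fun_higher_DERIV[OF assms(1)] smooth_fun_higher_DERIV[OF assms(2)]]
  by simp

lemma higher_deriv_compose_affine:
  assumes "smooth_fun u"
  shows "(deriv ^^ k) (\<lambda>x. u (a * x + b)) = (\<lambda>x. a ^ k * (deriv ^^ k) u (a * x + b))"
proof -
  have "((\<lambda>x. a ^ k * (deriv ^^ k) u (a * x + b)) has_real_derivative
      a ^ Suc k * (deriv ^^ Suc k) u (a * x + b)) (at x)" for k x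
  proof -
    have "((\<lambda>x. a * x + b) has_real_derivative a) (at x)" by (auto intro!: derivative_eq_intros)
    from DERIV_cmult[OF DERIV_chain2[OF smooth_fun_higher_DERIV[OF assms] this], of "a ^ k"]
    show ?thesis by (simp add: mult_ac)
  qed
  from higher_deriv_eqI[of "\<lambda>k x. a ^ k * (deriv ^^ k) u (a * x + b)", OF this]
  show ?thesis by simp
qed

subsection \<open>Jet norms\<close>

definition jet_norm :: "nat \<Rightarrow> (real \<Rightarrow> real) \<Rightarrow> real \<Rightarrow> real" where
  "jet_norm k u x = (MAX j\<in>{..k}. \<bar>(deriv ^^ j) u x\<bar>)"

lemma jet_norm_le_iff: "jet_norm k u x \<le> B \<longleftrightarrow> (\<forall>j\<le>k. \<bar>(deriv ^^ j) u x\<bar> \<le> B)"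
  by (auto simp: jet_norm_def)

lemma abs_higher_deriv_le_jet_norm: "j \<le> k \<Longrightarrow> \<bar>(deriv ^^ j) u x\<bar> \<le> jet_norm k u x"
  using jet_norm_le_iff by blast

lemma jet_norm_cong_ev:
  "\<forall>\<^sub>F y in nhds x. u y = v y \<Longrightarrow> jet_norm k u x = jet_norm k v x"
  unfolding jet_norm_def by (simp only: higher_deriv_cong_ev[OF _ refl])

lemma jet_norm_nonneg [simp]: "jet_norm k u x \<ge> 0"
  using abs_higher_deriv_le_jet_norm[of 0 k u x] by simp

lemma jet_norm_mono: "j \<le> k \<Longrightarrow> jet_norm j u x \<le> jet_norm k u x"
  by (auto simp: jet_norm_le_iff intro: abs_higher_deriv_le_jet_norm)

lemma jet_norm_deriv_le: "jet_norm k (deriv u) x \<le> jet_norm (Suc k) u x"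
  unfolding jet_norm_le_iff higher_deriv_deriv
  by (intro allI impI abs_higher_deriv_le_jet_norm) simp

lemma jet_norm_diff_le:
  assumes "smooth_fun u" "smooth_fun v"
  shows "jet_norm k (\<lambda>x. u x - v x) x \<le> jet_norm k u x + jet_norm k v x"
  unfolding jet_norm_le_iff higher_deriv_diff_smooth_fun[OF assms]
  by (auto intro!: order_trans[OF abs_triangle_ineq4] add_mono abs_higher_deriv_le_jet_norm)

lemma abs_higher_deriv_mult_le:
  assumes "smooth_fun u" "smooth_fun v"
  shows "\<bar>(deriv ^^ k) (\<lambda>x. u x * v x) x\<bar> \<le> 2 ^ k * (jet_norm k u x * jet_norm k v x)"
  using assms
proof (induction k arbitrary: u v)
  case 0
  then show ?case by (simp add: jet_norm_def abs_mult)
next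
  case (Suc k)
  note smooth = Suc.prems smooth_fun_deriv[OF Suc.prems(1)] smooth_fun_deriv[OF Suc.prems(2)]
  let ?B = "2 ^ k * (jet_norm (Suc k) u x * jet_norm (Suc k) v x)"
  have "(deriv ^^ Suc k) (\<lambda>x. u x * v x) = (deriv ^^ k) (\<lambda>x. deriv u x * v x + u x * deriv v x)"
    unfolding higher_deriv_deriv[symmetric] deriv_mult_smooth_fun[OF Suc.prems] ..
  then have "\<bar>(deriv ^^ Suc k) (\<lambda>x. u x * v x) x\<bar>
      \<le> \<bar>(deriv ^^ k) (\<lambda>x. deriv u x * v x) x\<bar> + \<bar>(deriv ^^ k) (\<lambda>x. u x * deriv v x) x\<bar>"
    by (simp only: higher_deriv_add_smooth_fun smooth_fun_mult smooth abs_triangle_ineq)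
  moreover have "\<bar>(deriv ^^ k) (\<lambda>x. deriv u x * v x) x\<bar> \<le> ?B"
    by (rule order_trans[OF Suc.IH])
      (auto intro!: mult_mono jet_norm_mono jet_norm_deriv_le smooth)
  moreover have "\<bar>(deriv ^^ k) (\<lambda>x. u x * deriv v x) x\<bar> \<le> ?B"
    by (rule order_trans[OF Suc.IH])
      (auto intro!: mult_mono jet_norm_mono jet_norm_deriv_le smooth)
  ultimately show ?case by simp
qed

lemma jet_norm_mult_le:
  assumes "smooth_fun u" "smooth_fun v"
  shows "jet_norm k (\<lambda>x. u x * v x) x \<le> 2 ^ k * (jet_norm k u x * jet_norm k v x)"
  unfolding jet_norm_le_iff
proof (intro allI impI order_trans[OF abs_higher_deriv_mult_le[OF assms]])
  show "2 ^ j * (jet_norm j u x * jet_norm j v x) \<le> 2 ^ k * (jet_norm k u x * jet_norm k v x)"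
    if "j \<le> k" for j
    using that by (intro mult_mono power_increasing jet_norm_mono) auto
qed

lemma jet_norm_compose_affine_le:
  assumes "smooth_fun u"
  shows "jet_norm k (\<lambda>x. u (a * x + b)) x \<le> max 1 \<bar>a\<bar> ^ k * jet_norm k u (a * x + b)"
  unfolding jet_norm_le_iff higher_deriv_compose_affine[OF assms] abs_mult power_abs
proof (intro allI impI mult_mono abs_higher_deriv_le_jet_norm)
  show "\<bar>a\<bar> ^ j \<le> max 1 \<bar>a\<bar> ^ k" if "j \<le> k" for j
    using that by (intro order_trans[OF power_mono power_increasing]) auto
qed auto

lemma jet_norm_bounded:
  assumes w: "\<And>x. w x \<ge> 0" and bounded: "\<And>j. \<exists>B. \<forall>x. \<bar>(deriv ^^ j) u x\<bar> \<le> B * w x"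
  shows "\<exists>B\<ge>0. \<forall>x. jet_norm k u x \<le> B * w x"
proof -
  obtain b where b: "\<bar>(deriv ^^ j) u x\<bar> \<le> b j * w x" for j x
    using choice[of "\<lambda>j B. \<forall>x. \<bar>(deriv ^^ j) u x\<bar> \<le> B * w x"] bounded by blast
  let ?B = "\<Sum>j\<le>k. \<bar>b j\<bar>"
  have "\<bar>(deriv ^^ j) u x\<bar> \<le> ?B * w x" if "j \<le> k" for j x
  proof -
    have "b j \<le> \<bar>b j\<bar>" by simp
    also have "\<dots> \<le> ?B" using that by (intro member_le_sum) auto
    finally have "b j * w x \<le> ?B * w x" using w by (rule mult_right_mono)
    with b show ?thesis by (rule order_trans)
  qed
  then show ?thesis
    by (intro exI[of _ ?B]) (simp add: jet_norm_le_iff sum_nonneg)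
qed

subsection \<open>Smooth steps and cutoffs\<close>

definition poly_flat_exp :: "real poly \<Rightarrow> real \<Rightarrow> real" where
  "poly_flat_exp p x = (if x > 0 then poly p (1 / x) * exp (- 1 / x) else 0)"

lemma tendsto_poly_div_exp_0: "((\<lambda>x::real. poly p x / exp x) \<longlongrightarrow> 0) at_top"
proof -
  have "((\<lambda>x::real. \<Sum>i\<le>degree p. coeff p i * (x ^ i / exp x))
      \<longlongrightarrow> (\<Sum>i\<le>degree p. coeff p i * 0)) at_top"
    by (intro tendsto_sum tendsto_mult tendsto_const tendsto_power_div_exp_0)
  then show ?thesis by (simp add: poly_altdef sum_divide_distrib)
qed

lemma DERIV_poly_flat_exp_0: "(poly_flat_exp p has_real_derivative 0) (at 0)"
proof -
  let ?slope = "\<lambda>h. (poly_flat_exp p (0 + h) - poly_flat_exp p 0) / h"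
  have "((\<lambda>h. poly (pCons 0 p) (inverse h) / exp (inverse h)) \<longlongrightarrow> 0) (at_right 0)"
    by (rule filterlim_compose[OF tendsto_poly_div_exp_0 filterlim_inverse_at_top_right])
  then have "(?slope \<longlongrightarrow> 0) (at_right 0)"
    by (rule Lim_transform_eventually)
       (auto simp: poly_flat_exp_def eventually_at_filter field_simps exp_minus)
  moreover have "(?slope \<longlongrightarrow> 0) (at_left 0)"
    by (rule Lim_transform_eventually[OF tendsto_const])
       (auto simp: poly_flat_exp_def eventually_at_filter)
  ultimately show ?thesis
    unfolding DERIV_def by (simp only: filterlim_split_at)
qed

lemma DERIV_poly_flat_exp:
  "(poly_flat_exp p has_real_derivative poly_flat_exp ([:0, 0, 1:] * (p - pderiv p)) x) (at x)"
proof -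
  consider (pos) "x > 0" | (neg) "x < 0" | (zero) "x = 0" by linarith
  then show ?thesis
  proof cases
    case pos
    have "((\<lambda>x. poly p (1 / x) * exp (- 1 / x)) has_real_derivative
        poly_flat_exp ([:0, 0, 1:] * (p - pderiv p)) x) (at x)"
      by (rule derivative_eq_intros DERIV_chain2[OF poly_DERIV] refl | use pos in \<open>simp; fail\<close>)+
         (use pos in \<open>simp add: poly_flat_exp_def field_simps power2_eq_square\<close>)
    then show ?thesis
      by (rule has_field_derivative_transform_within_open[where S = "{0<..}"])
         (use pos in \<open>auto simp: poly_flat_exp_def\<close>)
  next
    case neg
    show ?thesis
      by (rule has_field_derivative_transform_within_open[where S = "{..<0}" and f = "\<lambda>_. 0"])
         (use neg in \<open>auto simp: poly_flat_exp_def\<close>)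
  next
    case zero
    then show ?thesis using DERIV_poly_flat_exp_0 by (simp add: poly_flat_exp_def)
  qed
qed

definition flat_exp :: "real \<Rightarrow> real" where
  "flat_exp x = (if x > 0 then exp (- 1 / x) else 0)"

lemma smooth_fun_flat_exp: "smooth_fun flat_exp"
proof (rule smooth_funI_deriv_closed)
  have "flat_exp = poly_flat_exp 1" by (auto simp: flat_exp_def poly_flat_exp_def)
  then show "flat_exp \<in> range poly_flat_exp" by blast
  show "\<exists>w\<in>range poly_flat_exp. \<forall>x. (v has_real_derivative w x) (at x)"
    if "v \<in> range poly_flat_exp" for v
    using that DERIV_poly_flat_exp by blast
qed

lemma flat_exp_nonneg: "flat_exp x \<ge> 0"
  by (simp add: flat_exp_def)

lemma flat_exp_sum_pos: "flat_exp x + flat_exp (1 - x) > 0"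
  by (cases "x > 0") (auto simp: flat_exp_def add_pos_nonneg add_nonneg_pos)

definition smooth_step :: "real \<Rightarrow> real" where
  "smooth_step x = flat_exp x * inverse (flat_exp x + flat_exp (1 - x))"

lemma smooth_fun_smooth_step: "smooth_fun smooth_step"
proof -
  have "smooth_fun (\<lambda>x. flat_exp (1 - x))"
    using smooth_fun_compose[OF smooth_fun_flat_exp smooth_fun_affine[of "-1" 1]] by simp
  then have "smooth_fun (\<lambda>x. flat_exp x * inverse (flat_exp x + flat_exp (1 - x)))"
    using flat_exp_sum_pos
    by (intro smooth_fun_mult smooth_fun_inverse smooth_fun_add smooth_fun_flat_exp)
       (auto simp: less_imp_neq[symmetric])
  then show ?thesis by (simp add: smooth_step_def[abs_def])
qed

lemma smooth_step_eq_0: "x \<le> 0 \<Longrightarrow> smooth_step x = 0"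
  by (simp add: smooth_step_def flat_exp_def)

lemma smooth_step_eq_1: "x \<ge> 1 \<Longrightarrow> smooth_step x = 1"
  by (simp add: smooth_step_def flat_exp_def)

lemma smooth_step_bounds: "0 \<le> smooth_step x" "smooth_step x \<le> 1"
  using flat_exp_nonneg[of x] flat_exp_nonneg[of "1 - x"] flat_exp_sum_pos[of x]
  by (auto simp: smooth_step_def field_simps)

lemma higher_deriv_eq_0_if_locally_const:
  fixes u :: "'a::real_normed_field \<Rightarrow> 'a"
  assumes "\<forall>\<^sub>F y in nhds x. u y = c" and "k > 0"
  shows "(deriv ^^ k) u x = 0"
proof -
  have "(deriv ^^ k) u x = (deriv ^^ k) (\<lambda>_. c) x"
    by (rule higher_deriv_cong_ev[OF assms(1) refl])
  also have "\<dots> = 0"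
    using higher_deriv_eqI[of "\<lambda>j _. if j = 0 then c else 0" k] assms(2) by simp
  finally show ?thesis .
qed

lemma higher_deriv_eq_0_outside_Icc:
  fixes u :: "real \<Rightarrow> real"
  assumes "\<And>x. x < a \<Longrightarrow> u x = c" and "\<And>x. x > b \<Longrightarrow> u x = d"
    and "k > 0" and "x \<notin> {a..b}"
  shows "(deriv ^^ k) u x = 0"
proof -
  from \<open>x \<notin> {a..b}\<close> consider (left) "x < a" | (right) "x > b" by fastforce
  then show ?thesis
  proof cases
    case left
    then have "\<forall>\<^sub>F y in nhds x. y \<in> {..<a}" by (intro eventually_nhds_in_open) auto
    then have "\<forall>\<^sub>F y in nhds x. u y = c" by eventually_elim (simp add: assms(1))
    then show ?thesis using \<open>k > 0\<close> by (rule higher_deriv_eq_0_if_locally_const)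
  next
    case right
    then have "\<forall>\<^sub>F y in nhds x. y \<in> {b<..}" by (intro eventually_nhds_in_open) auto
    then have "\<forall>\<^sub>F y in nhds x. u y = d" by eventually_elim (simp add: assms(2))
    then show ?thesis using \<open>k > 0\<close> by (rule higher_deriv_eq_0_if_locally_const)
  qed
qed

lemma bounded_if_zero_outside_Icc:
  fixes u :: "real \<Rightarrow> real"
  assumes "continuous_on {a..b} u" and "\<And>x. x \<notin> {a..b} \<Longrightarrow> u x = 0"
  shows "\<exists>B. \<forall>x. \<bar>u x\<bar> \<le> B"
proof -
  obtain B where B: "\<forall>x\<in>{a..b}. \<bar>u x\<bar> \<le> B"
    using compact_imp_bounded[OF compact_continuous_image[OF assms(1) compact_Icc]]
    by (auto simp: bounded_iff)
  have "\<bar>u x\<bar> \<le> max B 0" for x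
    using bspec[OF B, of x] assms(2)[of x] by (cases "x \<in> {a..b}") auto
  then show ?thesis by blast
qed

lemma jet_norm_smooth_step_bounded: "\<exists>B\<ge>0. \<forall>x. jet_norm k smooth_step x \<le> B"
proof -
  have "\<exists>B. \<forall>x. \<bar>(deriv ^^ j) smooth_step x\<bar> \<le> B * 1" for j
  proof (cases "j = 0")
    case True
    then show ?thesis using smooth_step_bounds by (intro exI[of _ 1]) (auto simp: abs_le_iff)
  next
    case False
    have "(deriv ^^ j) smooth_step x = 0" if "x \<notin> {0..1}" for x
      using higher_deriv_eq_0_outside_Icc[of 0 smooth_step 0 1 1 j x] that False
      by (simp add: smooth_step_eq_0 smooth_step_eq_1)
    then show ?thesis
      using bounded_if_zero_outside_Icc[of 0 1 "(deriv ^^ j) smooth_step"]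
        smooth_fun_continuous_on smooth_fun_higher_deriv smooth_fun_smooth_step by simp
  qed
  from jet_norm_bounded[OF _ this] show ?thesis by simp
qed

definition smooth_cutoff :: "real \<Rightarrow> real \<Rightarrow> real \<Rightarrow> real \<Rightarrow> real" where
  "smooth_cutoff w a b x = smooth_step ((x - a) / w + 1) - smooth_step ((x - b) / w)"

lemma smooth_cutoff_affine:
  "smooth_cutoff w a b =
    (\<lambda>x. smooth_step (1 / w * x + (1 - a / w)) - smooth_step (1 / w * x + - b / w))"
  by (simp add: smooth_cutoff_def fun_eq_iff diff_divide_distrib algebra_simps)

lemma smooth_fun_smooth_cutoff: "smooth_fun (smooth_cutoff w a b)"
  unfolding smooth_cutoff_affine
  by (intro smooth_fun_diff smooth_fun_compose[OF smooth_fun_smooth_step] smooth_fun_affine)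

lemma smooth_cutoff_eq_1: "w > 0 \<Longrightarrow> x \<in> {a..b} \<Longrightarrow> smooth_cutoff w a b x = 1"
  by (simp add: smooth_cutoff_def smooth_step_eq_0 smooth_step_eq_1 divide_le_0_iff)

lemma smooth_cutoff_eq_0:
  assumes "w > 0" "a \<le> b" "x \<notin> {a - w..b + w}"
  shows "smooth_cutoff w a b x = 0"
proof -
  from assms(3) consider (left) "x \<le> a - w" | (right) "x \<ge> b + w" by fastforce
  then show ?thesis
  proof cases
    case left
    then have "(x - a) / w + 1 \<le> 0" "(x - b) / w \<le> 0"
      using assms(1,2) by (auto simp: field_simps)
    then show ?thesis by (simp add: smooth_cutoff_def smooth_step_eq_0)
  next
    case right
    then have "(x - a) / w + 1 \<ge> 1" "(x - b) / w \<ge> 1"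
      using assms(1,2) by (auto simp: field_simps)
    then show ?thesis by (simp add: smooth_cutoff_def smooth_step_eq_1)
  qed
qed

lemma smooth_cutoff_bounds:
  assumes "w > 0" "a \<le> b"
  shows "0 \<le> smooth_cutoff w a b x" "smooth_cutoff w a b x \<le> 1"
proof -
  have "x \<le> b \<Longrightarrow> smooth_step ((x - b) / w) = 0" "x \<ge> b \<Longrightarrow> smooth_step ((x - a) / w + 1) = 1"
    using assms by (auto simp: smooth_step_eq_0 smooth_step_eq_1 divide_le_0_iff)
  then show "0 \<le> smooth_cutoff w a b x" "smooth_cutoff w a b x \<le> 1"
    using smooth_step_bounds[of "(x - a) / w + 1"] smooth_step_bounds[of "(x - b) / w"]
    by (auto simp: smooth_cutoff_def intro: linorder_le_cases[of x b])
qed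

lemma jet_norm_smooth_cutoff_bounded:
  "\<exists>B\<ge>0. \<forall>w>0. \<forall>a b x. jet_norm k (smooth_cutoff w a b) x \<le> B * max 1 (1 / w) ^ k"
proof -
  obtain B where B: "B \<ge> 0" "\<And>x. jet_norm k smooth_step x \<le> B"
    using jet_norm_smooth_step_bounded by blast
  have "jet_norm k (smooth_cutoff w a b) x \<le> 2 * B * max 1 (1 / w) ^ k" if "w > 0" for w a b x
  proof -
    have step: "jet_norm k (\<lambda>x. smooth_step (1 / w * x + c)) x \<le> max 1 (1 / w) ^ k * B" for c
      using \<open>w > 0\<close> B(2) mult_left_mono
      by (intro order_trans[OF jet_norm_compose_affine_le[OF smooth_fun_smooth_step]]) auto
    have "jet_norm k (smooth_cutoff w a b) x
        \<le> max 1 (1 / w) ^ k * B + max 1 (1 / w) ^ k * B"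
      unfolding smooth_cutoff_affine
      by (intro order_trans[OF jet_norm_diff_le] add_mono step
          smooth_fun_compose[OF smooth_fun_smooth_step] smooth_fun_affine)
    then show ?thesis by (simp add: mult_ac)
  qed
  then show ?thesis using B(1) by (intro exI[of _ "2 * B"]) auto
qed

subsection \<open>Gaussian weights\<close>

definition gauss_weight :: "real \<Rightarrow> real \<Rightarrow> real" where
  "gauss_weight \<beta> x = exp (- (\<beta> * x\<^sup>2) / 2)"

lemma gauss_weight_pos [simp]: "gauss_weight \<beta> x > 0"
  by (simp add: gauss_weight_def)

lemma gauss_weight_nonneg [simp]: "gauss_weight \<beta> x \<ge> 0"
  by (simp add: gauss_weight_def)

lemma gauss_weight_add: "gauss_weight (\<beta> + \<gamma>) x = gauss_weight \<beta> x * gauss_weight \<gamma> x"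
  by (simp add: gauss_weight_def field_simps flip: exp_add)

lemma gauss_weight_antimono: "\<beta> \<le> \<gamma> \<Longrightarrow> gauss_weight \<gamma> x \<le> gauss_weight \<beta> x"
  by (simp add: gauss_weight_def mult_right_mono)

lemma gauss_weight_le_split:
  assumes "\<beta> + \<delta> \<le> \<gamma>" "\<delta> \<ge> 0" "0 \<le> R" "R \<le> \<bar>x\<bar>"
  shows "gauss_weight \<gamma> x \<le> gauss_weight \<delta> R * gauss_weight \<beta> x"
proof -
  have "R\<^sup>2 \<le> x\<^sup>2" using assms(3,4) by (simp flip: abs_le_square_iff)
  then have "gauss_weight \<delta> x \<le> gauss_weight \<delta> R"
    using assms(2) by (simp add: gauss_weight_def mult_left_mono)
  then have "gauss_weight \<delta> x * gauss_weight \<beta> x \<le> gauss_weight \<delta> R * gauss_weight \<beta> x"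
    by (intro mult_right_mono) auto
  moreover have "gauss_weight \<gamma> x \<le> gauss_weight (\<delta> + \<beta>) x"
    using assms(1) by (intro gauss_weight_antimono) simp
  ultimately show ?thesis unfolding gauss_weight_add by linarith
qed

lemma gauss_rho_eq_gauss_weight: "gauss_rho x = gauss_weight 1 x / sqrt (2 * pi)"
  by (simp add: gauss_rho_def gauss_weight_def)

lemma gauss_rho_pos [simp]: "gauss_rho x > 0"
  by (simp add: gauss_rho_def)

lemma gauss_rho_nonneg [simp]: "gauss_rho x \<ge> 0"
  by (simp add: less_imp_le)

lemma gauss_rho_le_gauss_weight: "gauss_rho x \<le> gauss_weight 1 x"
proof -
  have "sqrt (2 * pi) \<ge> 1" using pi_gt3 by simp
  then show ?thesis
    using mult_left_mono[of 1 "sqrt (2 * pi)" "gauss_weight 1 x"]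
    by (simp add: gauss_rho_eq_gauss_weight divide_le_eq)
qed

lemma DERIV_poly_mult_gauss_rho:
  "((\<lambda>x. poly p x * gauss_rho x) has_real_derivative
     poly (pderiv p - [:0, 1:] * p) x * gauss_rho x) (at x)"
  unfolding gauss_rho_def
  by (rule derivative_eq_intros poly_DERIV refl | simp)+ (simp add: field_simps)

lemma gauss_rho_deriv_closed:
  defines "S \<equiv> range (\<lambda>p x. poly p x * gauss_rho x)"
  shows "gauss_rho \<in> S"
    and "v \<in> S \<Longrightarrow> \<exists>w\<in>S. \<forall>x. (v has_real_derivative w x) (at x)"
proof -
  show "gauss_rho \<in> S" unfolding S_def by (rule image_eqI[of _ _ 1]) auto
  assume "v \<in> S"
  then obtain p where v: "v = (\<lambda>x. poly p x * gauss_rho x)" by (auto simp: S_def)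
  show "\<exists>w\<in>S. \<forall>x. (v has_real_derivative w x) (at x)"
    unfolding v S_def
    by (intro bexI[of _ "\<lambda>x. poly (pderiv p - [:0, 1:] * p) x * gauss_rho x"] allI
        DERIV_poly_mult_gauss_rho rangeI)
qed

lemma smooth_fun_gauss_rho: "smooth_fun gauss_rho"
  by (rule smooth_funI_deriv_closed[OF gauss_rho_deriv_closed])

lemma gauss_rho_borel_measurable [measurable]: "gauss_rho \<in> borel_measurable borel"
  by (rule smooth_fun_borel_measurable[OF smooth_fun_gauss_rho])

lemma higher_deriv_gauss_rho: "\<exists>p. (deriv ^^ k) gauss_rho = (\<lambda>x. poly p x * gauss_rho x)"
  using higher_deriv_in_deriv_closed[OF gauss_rho_deriv_closed] by auto

lemma power_le_fact_mult_exp: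
  fixes y :: real
  assumes "y \<ge> 0"
  shows "y ^ i \<le> fact i * exp y"
proof -
  have "(\<Sum>n\<in>{i}. y ^ n /\<^sub>R fact n) \<le> (\<Sum>n. y ^ n /\<^sub>R fact n)"
    using assms by (intro sum_le_suminf summable_exp_generic) auto
  then show ?thesis by (simp add: exp_def field_simps)
qed

lemma abs_power_le_exp_square:
  fixes x c :: real
  assumes "c > 0"
  shows "\<bar>x\<bar> ^ i \<le> (1 + fact i / c ^ i) * exp (c * x\<^sup>2)"
proof -
  have "\<bar>x\<bar> ^ i \<le> 1 + (x\<^sup>2) ^ i"
  proof (cases "\<bar>x\<bar> \<le> 1")
    case True
    then show ?thesis using power_le_one[of "\<bar>x\<bar>" i] by (simp add: add_increasing2)
  next
    case False
    then have "\<bar>x\<bar> ^ i \<le> \<bar>x\<bar> ^ (2 * i)" by (intro power_increasing) auto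
    then show ?thesis by (simp add: power_mult)
  qed
  also have "(x\<^sup>2) ^ i \<le> fact i / c ^ i * exp (c * x\<^sup>2)"
    using power_le_fact_mult_exp[of "c * x\<^sup>2" i] assms by (simp add: field_simps)
  also have "1 \<le> exp (c * x\<^sup>2)" using assms by simp
  finally show ?thesis by (simp add: distrib_right)
qed

lemma poly_le_exp_square:
  fixes p :: "real poly"
  assumes "c > 0"
  shows "\<exists>K. \<forall>x. \<bar>poly p x\<bar> \<le> K * exp (c * x\<^sup>2)"
proof -
  define K where "K = (\<Sum>i\<le>degree p. \<bar>coeff p i\<bar> * (1 + fact i / c ^ i))"
  have "\<bar>poly p x\<bar> \<le> K * exp (c * x\<^sup>2)" for x
  proof -
    have "\<bar>poly p x\<bar> \<le> (\<Sum>i\<le>degree p. \<bar>coeff p i\<bar> * \<bar>x\<bar> ^ i)"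
      unfolding poly_altdef by (rule order_trans[OF sum_abs]) (simp add: abs_mult power_abs)
    also have "\<dots> \<le> (\<Sum>i\<le>degree p. \<bar>coeff p i\<bar> * ((1 + fact i / c ^ i) * exp (c * x\<^sup>2)))"
      by (intro sum_mono mult_left_mono abs_power_le_exp_square assms) simp
    finally show ?thesis by (simp add: K_def sum_distrib_right mult.assoc)
  qed
  then show ?thesis by blast
qed

lemma jet_norm_gauss_rho_le:
  assumes "\<theta> < 1"
  shows "\<exists>K\<ge>0. \<forall>x. jet_norm k gauss_rho x \<le> K * gauss_weight \<theta> x"
proof (rule jet_norm_bounded)
  fix j
  obtain p where p: "(deriv ^^ j) gauss_rho = (\<lambda>x. poly p x * gauss_rho x)"
    using higher_deriv_gauss_rho by blast
  obtain K where K: "\<And>x. \<bar>poly p x\<bar> \<le> K * exp ((1 - \<theta>) / 2 * x\<^sup>2)"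
    using poly_le_exp_square[of "(1 - \<theta>) / 2" p] assms by auto
  have "\<bar>(deriv ^^ j) gauss_rho x\<bar> \<le> K * gauss_weight \<theta> x" for x
  proof -
    have "\<bar>(deriv ^^ j) gauss_rho x\<bar> = \<bar>poly p x\<bar> * gauss_rho x" by (simp add: p abs_mult)
    also have "\<dots> \<le> (K * exp ((1 - \<theta>) / 2 * x\<^sup>2)) * gauss_weight 1 x"
      using order_trans[OF abs_ge_zero K]
      by (intro mult_mono K gauss_rho_le_gauss_weight) auto
    also have "\<dots> = K * gauss_weight \<theta> x"
      by (simp add: gauss_weight_def mult.assoc flip: exp_add) (simp add: field_simps)
    finally show ?thesis .
  qed
  then show "\<exists>K. \<forall>x. \<bar>(deriv ^^ j) gauss_rho x\<bar> \<le> K * gauss_weight \<theta> x" by blast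
qed simp

definition gauss_cutoff :: "real \<Rightarrow> real \<Rightarrow> real \<Rightarrow> real \<Rightarrow> real" where
  "gauss_cutoff w a b x = gauss_rho x * smooth_cutoff w a b x"

lemma smooth_fun_gauss_cutoff: "smooth_fun (gauss_cutoff w a b)"
  unfolding gauss_cutoff_def[abs_def]
  by (intro smooth_fun_mult smooth_fun_gauss_rho smooth_fun_smooth_cutoff)

lemma gauss_cutoff_eq_gauss_rho: "w > 0 \<Longrightarrow> x \<in> {a..b} \<Longrightarrow> gauss_cutoff w a b x = gauss_rho x"
  by (simp add: gauss_cutoff_def smooth_cutoff_eq_1)

lemma jet_norm_gauss_cutoff_eq:
  assumes "w > 0" "{- R..R} \<subseteq> {a..b}" "\<bar>x\<bar> < R"
  shows "jet_norm k (gauss_cutoff w a b) x = jet_norm k gauss_rho x"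
proof (rule jet_norm_cong_ev)
  have "\<forall>\<^sub>F y in nhds x. y \<in> {- R<..<R}"
    using assms(3) by (intro eventually_nhds_in_open) (auto simp: abs_less_iff)
  then show "\<forall>\<^sub>F y in nhds x. gauss_cutoff w a b y = gauss_rho y"
    by eventually_elim (use assms(1,2) in \<open>auto simp: subset_iff intro!: gauss_cutoff_eq_gauss_rho\<close>)
qed

lemma jet_norm_gauss_cutoff_tail_le:
  assumes "\<beta> + \<delta> < 1" "\<delta> \<ge> 0"
  shows "\<exists>K\<ge>0. \<forall>w>0. \<forall>a b R x. 0 \<le> R \<longrightarrow> R \<le> \<bar>x\<bar> \<longrightarrow>
    jet_norm k (gauss_cutoff w a b) x
      \<le> K * (max 1 (1 / w) ^ k * gauss_weight \<delta> R) * gauss_weight \<beta> x"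
proof -
  obtain K where K: "K \<ge> 0" "\<And>x. jet_norm k gauss_rho x \<le> K * gauss_weight (\<beta> + \<delta>) x"
    using jet_norm_gauss_rho_le[OF assms(1), of k] by blast
  obtain B where B: "B \<ge> 0"
      "\<And>w a b x. w > 0 \<Longrightarrow> jet_norm k (smooth_cutoff w a b) x \<le> B * max 1 (1 / w) ^ k"
    using jet_norm_smooth_cutoff_bounded[of k] by auto
  have bound: "jet_norm k (gauss_cutoff w a b) x
      \<le> 2 ^ k * K * B * (max 1 (1 / w) ^ k * gauss_weight \<delta> R) * gauss_weight \<beta> x"
    if "w > 0" "0 \<le> R" "R \<le> \<bar>x\<bar>" for w a b R x
  proof -
    have "gauss_weight (\<beta> + \<delta>) x \<le> gauss_weight \<delta> R * gauss_weight \<beta> x"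
      using that assms(2) by (intro gauss_weight_le_split) auto
    then have "jet_norm k gauss_rho x \<le> K * (gauss_weight \<delta> R * gauss_weight \<beta> x)"
      using K(1) by (intro order_trans[OF K(2)] mult_left_mono)
    then have "jet_norm k gauss_rho x * jet_norm k (smooth_cutoff w a b) x
        \<le> (K * (gauss_weight \<delta> R * gauss_weight \<beta> x)) * (B * max 1 (1 / w) ^ k)"
      using K(1) \<open>w > 0\<close> by (intro mult_mono B) auto
    then have "2 ^ k * (jet_norm k gauss_rho x * jet_norm k (smooth_cutoff w a b) x)
        \<le> 2 ^ k * K * B * (max 1 (1 / w) ^ k * gauss_weight \<delta> R) * gauss_weight \<beta> x"
      by (simp add: mult_ac)
    then show ?thesis
      unfolding gauss_cutoff_def[abs_def]
      by (rule order_trans[OF jet_norm_mult_le[OF smooth_fun_gauss_rho smooth_fun_smooth_cutoff]])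
  qed
  show ?thesis
    by (intro exI[of _ "2 ^ k * K * B"] conjI allI impI bound) (use K(1) B(1) in simp_all)
qed

lemma jet_norm_gauss_cutoff_le:
  assumes "\<beta> + \<delta> < 1" "\<delta> \<ge> 0"
  shows "\<exists>K\<ge>0. \<forall>w>0. \<forall>a b R x. 0 \<le> R \<longrightarrow> {- R..R} \<subseteq> {a..b} \<longrightarrow>
    jet_norm k (gauss_cutoff w a b) x
      \<le> K * (1 + max 1 (1 / w) ^ k * gauss_weight \<delta> R) * gauss_weight \<beta> x"
proof -
  obtain K where K: "K \<ge> 0" "\<And>x. jet_norm k gauss_rho x \<le> K * gauss_weight \<beta> x"
    using jet_norm_gauss_rho_le[of \<beta> k] assms by auto
  obtain M where M: "M \<ge> 0" "\<And>w a b R x. w > 0 \<Longrightarrow> 0 \<le> R \<Longrightarrow> R \<le> \<bar>x\<bar> \<Longrightarrow>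
      jet_norm k (gauss_cutoff w a b) x
        \<le> M * (max 1 (1 / w) ^ k * gauss_weight \<delta> R) * gauss_weight \<beta> x"
    using jet_norm_gauss_cutoff_tail_le[OF assms, of k] by blast
  have bound: "jet_norm k (gauss_cutoff w a b) x
      \<le> (K + M) * (1 + max 1 (1 / w) ^ k * gauss_weight \<delta> R) * gauss_weight \<beta> x"
    (is "?J \<le> (K + M) * (1 + ?s) * ?g")
    if "w > 0" "0 \<le> R" "{- R..R} \<subseteq> {a..b}" for w a b R x
  proof (cases "\<bar>x\<bar> < R")
    case True
    then have "?J \<le> K * 1 * ?g"
      using K(2) by (simp add: jet_norm_gauss_cutoff_eq[OF \<open>w > 0\<close> that(3)])
    also have "\<dots> \<le> (K + M) * (1 + ?s) * ?g"
      using K(1) M(1) by (intro mult_right_mono mult_mono) auto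
    finally show ?thesis .
  next
    case False
    then have "?J \<le> M * ?s * ?g" using that by (intro M) auto
    also have "\<dots> \<le> (K + M) * (1 + ?s) * ?g"
      using K(1) M(1) by (intro mult_right_mono mult_mono) auto
    finally show ?thesis .
  qed
  show ?thesis
    by (intro exI[of _ "K + M"] conjI allI impI bound) (use K(1) M(1) in simp_all)
qed

lemma abs_gauss_rho_diff_cutoff_le:
  assumes "\<beta> + \<delta> \<le> 1" "\<delta> \<ge> 0" "w > 0" "0 \<le> R" "{- R..R} \<subseteq> {a..b}"
  shows "\<bar>gauss_rho x - gauss_cutoff w a b x\<bar> \<le> gauss_weight \<delta> R * gauss_weight \<beta> x"
proof (cases "\<bar>x\<bar> \<le> R")
  case True
  then have "x \<in> {a..b}" using assms(5) by (auto simp: abs_le_iff)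
  then show ?thesis using assms(3) by (simp add: gauss_cutoff_eq_gauss_rho)
next
  case False
  have "a \<le> b" using assms(4,5) by auto
  then have "\<bar>gauss_rho x * (1 - smooth_cutoff w a b x)\<bar> \<le> gauss_rho x * 1"
    unfolding abs_mult using smooth_cutoff_bounds[OF assms(3)] by (intro mult_mono) auto
  also have "\<dots> \<le> gauss_weight 1 x" using gauss_rho_le_gauss_weight by simp
  also have "\<dots> \<le> gauss_weight \<delta> R * gauss_weight \<beta> x"
    using False assms by (intro gauss_weight_le_split) auto
  finally show ?thesis by (simp add: gauss_cutoff_def right_diff_distrib)
qed

lemma integrable_gauss_weight:
  assumes "\<beta> > 0"
  shows "integrable lborel (gauss_weight \<beta>)"
proof -
  let ?\<sigma> = "sqrt (1 / \<beta>)"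
  have "(\<lambda>x. sqrt (2 * pi * ?\<sigma>\<^sup>2) * normal_density 0 ?\<sigma> x) = gauss_weight \<beta>"
    using assms by (auto simp: normal_density_def gauss_weight_def)
  moreover have "integrable lborel (\<lambda>x. sqrt (2 * pi * ?\<sigma>\<^sup>2) * normal_density 0 ?\<sigma> x)"
    using assms by (intro integrable_mult_right integrable_normal_density) auto
  ultimately show ?thesis by simp
qed

subsection \<open>Pairing with weighted square-integrable functions\<close>

lemma Cauchy_Schwarz_integral:
  fixes f g :: "'a \<Rightarrow> real"
  assumes [measurable]: "f \<in> borel_measurable M" "g \<in> borel_measurable M"
    and f_square: "integrable M (\<lambda>x. (f x)\<^sup>2)" and g_square: "integrable M (\<lambda>x. (g x)\<^sup>2)"
  shows "integrable M (\<lambda>x. f x * g x)"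
    and "\<bar>\<integral>x. f x * g x \<partial>M\<bar> \<le> sqrt (\<integral>x. (f x)\<^sup>2 \<partial>M) * sqrt (\<integral>x. (g x)\<^sup>2 \<partial>M)"
proof -
  show product: "integrable M (\<lambda>x. f x * g x)"
  proof (rule Bochner_Integration.integrable_bound)
    show "integrable M (\<lambda>x. (f x)\<^sup>2 + (g x)\<^sup>2)"
      by (intro Bochner_Integration.integrable_add f_square g_square)
    have "\<bar>a * b\<bar> \<le> a\<^sup>2 + b\<^sup>2" for a b :: real
      using sum_squares_bound[of "\<bar>a\<bar>" "\<bar>b\<bar>"] abs_ge_zero[of "a * b"]
      unfolding abs_mult power2_abs by linarith
    then show "AE x in M. norm (f x * g x) \<le> norm ((f x)\<^sup>2 + (g x)\<^sup>2)" by simp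
  qed simp
  have "(\<integral>\<^sup>+x. ennreal \<bar>f x\<bar> * ennreal \<bar>g x\<bar> \<partial>M) = ennreal (\<integral>x. \<bar>f x * g x\<bar> \<partial>M)"
    using nn_integral_eq_integral[OF Bochner_Integration.integrable_abs[OF product]]
    by (simp add: abs_mult ennreal_mult)
  then have "ennreal ((\<integral>x. \<bar>f x * g x\<bar> \<partial>M)\<^sup>2) = (\<integral>\<^sup>+x. ennreal \<bar>f x\<bar> * ennreal \<bar>g x\<bar> \<partial>M)\<^sup>2"
    by (simp add: ennreal_power)
  also have "\<dots> \<le> (\<integral>\<^sup>+x. (ennreal \<bar>f x\<bar>)\<^sup>2 \<partial>M) * (\<integral>\<^sup>+x. (ennreal \<bar>g x\<bar>)\<^sup>2 \<partial>M)"
    by (rule Cauchy_Schwarz_nn_integral) measurable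
  also have "\<dots> = ennreal ((\<integral>x. (f x)\<^sup>2 \<partial>M) * (\<integral>x. (g x)\<^sup>2 \<partial>M))"
    using f_square g_square by (simp add: nn_integral_eq_integral ennreal_power ennreal_mult)
  finally have "(\<integral>x. \<bar>f x * g x\<bar> \<partial>M)\<^sup>2 \<le> (\<integral>x. (f x)\<^sup>2 \<partial>M) * (\<integral>x. (g x)\<^sup>2 \<partial>M)"
    by (subst (asm) ennreal_le_iff) auto
  then have "(\<integral>x. \<bar>f x * g x\<bar> \<partial>M) \<le> sqrt (\<integral>x. (f x)\<^sup>2 \<partial>M) * sqrt (\<integral>x. (g x)\<^sup>2 \<partial>M)"
    unfolding real_sqrt_mult[symmetric] by (rule real_le_rsqrt)
  then show "\<bar>\<integral>x. f x * g x \<partial>M\<bar> \<le> sqrt (\<integral>x. (f x)\<^sup>2 \<partial>M) * sqrt (\<integral>x. (g x)\<^sup>2 \<partial>M)"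
    using integral_abs_bound[of M "\<lambda>x. f x * g x"] by linarith
qed

text \<open>The norm in \<open>L\<^sup>2\<^bsub>1/\<rho>\<^esub>\<close>, the dual of \<open>L\<^sup>2\<^sub>\<rho>\<close>; the integral is finite only for \<open>\<beta> > 1/2\<close>.\<close>
definition gauss_dual_norm :: "real \<Rightarrow> real" where
  "gauss_dual_norm \<beta> = sqrt (\<integral>x. (gauss_weight \<beta> x)\<^sup>2 / gauss_rho x \<partial>lborel)"

lemma gauss_dual_norm_nonneg [simp]: "gauss_dual_norm \<beta> \<ge> 0"
  by (simp add: gauss_dual_norm_def)

lemma integrable_gauss_weight_square_div_gauss_rho:
  assumes "\<beta> > 1/2"
  shows "integrable lborel (\<lambda>x. (gauss_weight \<beta> x)\<^sup>2 / gauss_rho x)"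
proof -
  have "(gauss_weight \<beta> x)\<^sup>2 = gauss_weight (2 * \<beta> - 1) x * gauss_weight 1 x" for x
    using gauss_weight_add[of \<beta> \<beta>] gauss_weight_add[of "2 * \<beta> - 1" 1]
    by (simp add: power2_eq_square)
  then have "(\<lambda>x. (gauss_weight \<beta> x)\<^sup>2 / gauss_rho x)
      = (\<lambda>x. sqrt (2 * pi) * gauss_weight (2 * \<beta> - 1) x)"
    by (simp add: gauss_rho_eq_gauss_weight fun_eq_iff less_imp_neq[symmetric])
  then show ?thesis
    using assms by (simp add: integrable_gauss_weight)
qed

lemma dual_norm_le_gauss_dual_norm:
  assumes "\<beta> > 1/2" and [measurable]: "\<psi> \<in> borel_measurable borel"
    and bound: "\<And>x. \<bar>\<psi> x\<bar> \<le> K * gauss_weight \<beta> x"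
  shows "integrable lborel (\<lambda>x. (\<psi> x)\<^sup>2 / gauss_rho x)"
    and "sqrt (\<integral>x. (\<psi> x)\<^sup>2 / gauss_rho x \<partial>lborel) \<le> K * gauss_dual_norm \<beta>"
proof -
  let ?w = "\<lambda>x. K\<^sup>2 * ((gauss_weight \<beta> x)\<^sup>2 / gauss_rho x)"
  have K: "K \<ge> 0" using order_trans[OF abs_ge_zero bound[of 0]] by (simp add: gauss_weight_def)
  have w: "integrable lborel ?w"
    by (intro integrable_mult_right integrable_gauss_weight_square_div_gauss_rho assms(1))
  have square_le: "(\<psi> x)\<^sup>2 / gauss_rho x \<le> ?w x" for x
    using power_mono[OF bound[of x], of 2] by (simp add: power_mult_distrib divide_right_mono)
  show square: "integrable lborel (\<lambda>x. (\<psi> x)\<^sup>2 / gauss_rho x)"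
    by (rule Bochner_Integration.integrable_bound[OF w]) (use square_le in auto)
  have "sqrt (\<integral>x. (\<psi> x)\<^sup>2 / gauss_rho x \<partial>lborel) \<le> sqrt (\<integral>x. ?w x \<partial>lborel)"
    using square w square_le by (intro real_sqrt_le_mono integral_mono)
  also have "(\<integral>x. ?w x \<partial>lborel) = K\<^sup>2 * (\<integral>x. (gauss_weight \<beta> x)\<^sup>2 / gauss_rho x \<partial>lborel)"
    by (rule integral_mult_right_zero)
  finally show "sqrt (\<integral>x. (\<psi> x)\<^sup>2 / gauss_rho x \<partial>lborel) \<le> K * gauss_dual_norm \<beta>"
    using K by (simp add: gauss_dual_norm_def real_sqrt_mult)
qed

lemma L2rho_pairing_bound:
  assumes "\<beta> > 1/2" and g: "in_L2rho g" and \<psi> [measurable]: "\<psi> \<in> borel_measurable borel"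
    and bound: "\<And>x. \<bar>\<psi> x\<bar> \<le> K * gauss_weight \<beta> x"
  shows "integrable lborel (\<lambda>x. g x * \<psi> x)"
    and "\<bar>\<integral>x. g x * \<psi> x \<partial>lborel\<bar> \<le> K * gauss_dual_norm \<beta> * L2rho_norm g"
proof -
  let ?u = "\<lambda>x. g x * sqrt (gauss_rho x)" and ?v = "\<lambda>x. \<psi> x / sqrt (gauss_rho x)"
  have [measurable]: "g \<in> borel_measurable borel"
    and g_square: "integrable lborel (\<lambda>x. (g x)\<^sup>2 * gauss_rho x)"
    using g by (auto simp: in_L2rho_def)
  note dual = dual_norm_le_gauss_dual_norm[OF assms(1) \<psi> bound]
  have squares: "(?u x)\<^sup>2 = (g x)\<^sup>2 * gauss_rho x" "(?v x)\<^sup>2 = (\<psi> x)\<^sup>2 / gauss_rho x" for x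
    by (simp_all add: power_mult_distrib power_divide)
  have product: "?u x * ?v x = g x * \<psi> x" for x by (simp add: less_imp_neq[symmetric])
  have Cauchy_Schwarz: "integrable lborel (\<lambda>x. ?u x * ?v x)"
    "\<bar>\<integral>x. ?u x * ?v x \<partial>lborel\<bar> \<le> sqrt (\<integral>x. (?u x)\<^sup>2 \<partial>lborel) * sqrt (\<integral>x. (?v x)\<^sup>2 \<partial>lborel)"
    using g_square dual(1) by (intro Cauchy_Schwarz_integral; simp add: squares)+
  show "integrable lborel (\<lambda>x. g x * \<psi> x)" using Cauchy_Schwarz(1) unfolding product .
  have "\<bar>\<integral>x. g x * \<psi> x \<partial>lborel\<bar> \<le> L2rho_norm g * sqrt (\<integral>x. (\<psi> x)\<^sup>2 / gauss_rho x \<partial>lborel)"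
    using Cauchy_Schwarz(2) unfolding product squares L2rho_norm_def .
  also have "\<dots> \<le> L2rho_norm g * (K * gauss_dual_norm \<beta>)"
    by (intro mult_left_mono dual(2)) (simp add: L2rho_norm_def)
  finally show "\<bar>\<integral>x. g x * \<psi> x \<partial>lborel\<bar> \<le> K * gauss_dual_norm \<beta> * L2rho_norm g"
    by (simp add: mult_ac)
qed

subsection \<open>Test functions and integration by parts\<close>

lemma test_fun_iff:
  "test_fun \<phi> \<longleftrightarrow> smooth_fun \<phi> \<and> (\<exists>R. \<forall>x. \<bar>x\<bar> > R \<longrightarrow> \<phi> x = 0)"
  by (simp add: test_fun_def smooth_fun_def)

lemma test_fun_smooth: "test_fun \<phi> \<Longrightarrow> smooth_fun \<phi>"
  by (simp add: test_fun_iff)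

lemma test_fun_deriv:
  assumes "test_fun \<phi>"
  shows "test_fun (deriv \<phi>)"
proof -
  obtain R where R: "\<And>x. \<bar>x\<bar> > R \<Longrightarrow> \<phi> x = 0"
    using assms by (auto simp: test_fun_iff)
  have "deriv \<phi> x = 0" if "\<bar>x\<bar> > R" for x
    using higher_deriv_eq_0_outside_Icc[of "- R" \<phi> 0 R 0 1 x] R that
    by (auto simp: abs_if split: if_splits)
  then show ?thesis
    using smooth_fun_deriv[OF test_fun_smooth[OF assms]] by (auto simp: test_fun_iff)
qed

lemma test_fun_mult_smooth_fun:
  "test_fun \<psi> \<Longrightarrow> smooth_fun \<phi> \<Longrightarrow> test_fun (\<lambda>x. \<psi> x * \<phi> x)"
  using smooth_fun_mult by (fastforce simp: test_fun_iff)

lemma test_fun_le_gauss_weight: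
  assumes "test_fun \<phi>"
  shows "\<exists>B. \<forall>x. \<bar>\<phi> x\<bar> \<le> B * gauss_weight \<beta> x"
proof -
  obtain R where R: "\<And>x. \<bar>x\<bar> > R \<Longrightarrow> \<phi> x = 0"
    using assms by (auto simp: test_fun_iff)
  have "continuous_on {-R..R} (\<lambda>x. \<phi> x / gauss_weight \<beta> x)"
    unfolding gauss_weight_def
    by (intro continuous_intros smooth_fun_continuous_on test_fun_smooth assms) auto
  moreover have "\<phi> x / gauss_weight \<beta> x = 0" if "x \<notin> {-R..R}" for x
    using R[of x] that by auto
  ultimately obtain B where "\<forall>x. \<bar>\<phi> x / gauss_weight \<beta> x\<bar> \<le> B"
    using bounded_if_zero_outside_Icc by blast
  then show ?thesis by (auto simp: pos_divide_le_eq)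
qed

lemma L2rho_test_fun_integrable:
  assumes "in_L2rho g" "test_fun \<phi>"
  shows "integrable lborel (\<lambda>x. g x * \<phi> x)"
proof -
  obtain B where "\<And>x. \<bar>\<phi> x\<bar> \<le> B * gauss_weight 1 x"
    using test_fun_le_gauss_weight[OF assms(2)] by blast
  then show ?thesis
    using assms smooth_fun_borel_measurable[OF test_fun_smooth]
    by (intro L2rho_pairing_bound(1)[of 1 g \<phi> B]) auto
qed

lemma sobolev_H_in_L2rho: "sobolev_H \<alpha> f g \<Longrightarrow> i \<le> \<alpha> \<Longrightarrow> in_L2rho (g i)"
  by (simp add: sobolev_H_def)

lemma L2rho_norm_le_sobolev_norm: "i \<le> \<alpha> \<Longrightarrow> L2rho_norm (g i) \<le> sobolev_norm \<alpha> g"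
  unfolding sobolev_norm_def
  by (intro real_le_rsqrt member_le_sum[where f = "\<lambda>i. (L2rho_norm (g i))\<^sup>2"]) auto

lemma sobolev_norm_nonneg [simp]: "sobolev_norm \<alpha> g \<ge> 0"
  by (simp add: sobolev_norm_def sum_nonneg)

lemma sobolev_H_weak_deriv:
  assumes "sobolev_H \<alpha> f g" "i \<le> \<alpha>" "test_fun \<eta>"
  shows "(\<integral>x. f x * (deriv ^^ i) \<eta> x \<partial>lborel) = (- 1) ^ i * (\<integral>x. g i x * \<eta> x \<partial>lborel)"
proof (cases "i = 0")
  case False
  then have "weak_deriv i f (g i)" using assms by (simp add: sobolev_H_def)
  then show ?thesis using assms(3) by (simp add: weak_deriv_def)
qed (use assms in \<open>simp add: sobolev_H_def\<close>)

lemma sobolev_H_integral_by_parts: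
  assumes sobolev: "sobolev_H \<alpha> f g" and "i < \<alpha>" and \<eta>: "test_fun \<eta>"
  shows "(\<integral>x. g i x * deriv \<eta> x \<partial>lborel) = - (\<integral>x. g (Suc i) x * \<eta> x \<partial>lborel)"
proof -
  have "(- 1) ^ i * (\<integral>x. g i x * deriv \<eta> x \<partial>lborel) = (\<integral>x. f x * (deriv ^^ i) (deriv \<eta>) x \<partial>lborel)"
    using sobolev_H_weak_deriv[OF sobolev _ test_fun_deriv[OF \<eta>], of i] \<open>i < \<alpha>\<close> by simp
  also have "\<dots> = (- 1) ^ Suc i * (\<integral>x. g (Suc i) x * \<eta> x \<partial>lborel)"
    unfolding higher_deriv_deriv using \<open>i < \<alpha>\<close> by (intro sobolev_H_weak_deriv[OF sobolev _ \<eta>]) simp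
  finally have "(- 1) ^ i * (\<integral>x. g i x * deriv \<eta> x \<partial>lborel)
      = (- 1) ^ i * - (\<integral>x. g (Suc i) x * \<eta> x \<partial>lborel)" by simp
  then show ?thesis by (subst (asm) mult_left_cancel) auto
qed

lemma sobolev_H_integral_by_parts_mult:
  assumes sobolev: "sobolev_H \<alpha> f g" and i: "i < \<alpha>" and \<psi>: "test_fun \<psi>" and \<phi>: "smooth_fun \<phi>"
  shows "(\<integral>x. g i x * (\<psi> x * deriv \<phi> x) \<partial>lborel)
    = - (\<integral>x. g (Suc i) x * (\<psi> x * \<phi> x) \<partial>lborel) - (\<integral>x. g i x * (deriv \<psi> x * \<phi> x) \<partial>lborel)"
proof -
  note g = sobolev_H_in_L2rho[OF sobolev less_imp_le[OF i]]
  note \<psi>\<phi> = test_fun_mult_smooth_fun[OF \<psi> \<phi>]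
  have "(\<integral>x. g i x * (\<psi> x * deriv \<phi> x) \<partial>lborel)
      = (\<integral>x. g i x * deriv (\<lambda>x. \<psi> x * \<phi> x) x - g i x * (deriv \<psi> x * \<phi> x) \<partial>lborel)"
    unfolding deriv_mult_smooth_fun[OF test_fun_smooth[OF \<psi>] \<phi>] by (simp add: algebra_simps)
  also have "\<dots> = (\<integral>x. g i x * deriv (\<lambda>x. \<psi> x * \<phi> x) x \<partial>lborel)
      - (\<integral>x. g i x * (deriv \<psi> x * \<phi> x) \<partial>lborel)"
    by (intro Bochner_Integration.integral_diff L2rho_test_fun_integrable g test_fun_deriv \<psi>\<phi>
        test_fun_mult_smooth_fun \<psi> \<phi>)
  finally show ?thesis by (simp only: sobolev_H_integral_by_parts[OF sobolev i \<psi>\<phi>])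
qed

lemma sobolev_H_pairing_bound:
  assumes sobolev: "sobolev_H \<alpha> f g" and "\<beta> > 1/2" and i: "i \<le> \<alpha>"
    and smooth: "smooth_fun \<psi>" and bound: "\<And>x. \<bar>\<psi> x\<bar> \<le> K * gauss_weight \<beta> x"
  shows "\<bar>\<integral>x. g i x * \<psi> x \<partial>lborel\<bar> \<le> K * gauss_dual_norm \<beta> * sobolev_norm \<alpha> g"
proof -
  have K: "K \<ge> 0" using order_trans[OF abs_ge_zero bound[of 0]] by (simp add: gauss_weight_def)
  have "\<bar>\<integral>x. g i x * \<psi> x \<partial>lborel\<bar> \<le> K * gauss_dual_norm \<beta> * L2rho_norm (g i)"
    by (intro L2rho_pairing_bound(2)[OF assms(2)] sobolev_H_in_L2rho[OF sobolev i]
        smooth_fun_borel_measurable smooth bound)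
  also have "\<dots> \<le> K * gauss_dual_norm \<beta> * sobolev_norm \<alpha> g"
    using K by (intro mult_left_mono L2rho_norm_le_sobolev_norm i) simp
  finally show ?thesis .
qed

lemma sobolev_H_pairing_higher_deriv_bound:
  assumes sobolev: "sobolev_H \<alpha> f g" and \<beta>: "\<beta> > 1/2" and "i + k \<le> \<alpha>"
    and "test_fun \<psi>" "smooth_fun \<phi>"
    and "\<And>x. jet_norm k \<psi> x * \<bar>\<phi> x\<bar> \<le> K * gauss_weight \<beta> x"
  shows "\<bar>\<integral>x. g i x * (\<psi> x * (deriv ^^ k) \<phi> x) \<partial>lborel\<bar>
      \<le> 2 ^ k * (K * gauss_dual_norm \<beta> * sobolev_norm \<alpha> g)"
  using assms(3-)
proof (induction k arbitrary: i \<psi>)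
  case 0
  have "\<bar>\<psi> x * \<phi> x\<bar> \<le> K * gauss_weight \<beta> x" for x
    using 0(4)[of x] by (simp add: abs_mult jet_norm_def)
  then show ?case
    using 0 test_fun_smooth sobolev_H_pairing_bound[OF sobolev \<beta> _ smooth_fun_mult] by simp
next
  case (Suc k)
  let ?\<phi> = "(deriv ^^ k) \<phi>" and ?B = "2 ^ k * (K * gauss_dual_norm \<beta> * sobolev_norm \<alpha> g)"
  have "(\<integral>x. g i x * (\<psi> x * (deriv ^^ Suc k) \<phi> x) \<partial>lborel)
      = - (\<integral>x. g (Suc i) x * (\<psi> x * ?\<phi> x) \<partial>lborel) - (\<integral>x. g i x * (deriv \<psi> x * ?\<phi> x) \<partial>lborel)"
    using Suc.prems sobolev_H_integral_by_parts_mult[OF sobolev, of i \<psi> ?\<phi>] smooth_fun_higher_deriv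
    by simp
  moreover have "\<bar>\<integral>x. g (Suc i) x * (\<psi> x * ?\<phi> x) \<partial>lborel\<bar> \<le> ?B"
  proof (rule Suc.IH)
    show "jet_norm k \<psi> x * \<bar>\<phi> x\<bar> \<le> K * gauss_weight \<beta> x" for x
      by (rule order_trans[OF mult_right_mono[OF jet_norm_mono] Suc.prems(4)]) auto
  qed (use Suc.prems in auto)
  moreover have "\<bar>\<integral>x. g i x * (deriv \<psi> x * ?\<phi> x) \<partial>lborel\<bar> \<le> ?B"
  proof (rule Suc.IH)
    show "jet_norm k (deriv \<psi>) x * \<bar>\<phi> x\<bar> \<le> K * gauss_weight \<beta> x" for x
      by (rule order_trans[OF mult_right_mono[OF jet_norm_deriv_le] Suc.prems(4)]) auto
  qed (use Suc.prems test_fun_deriv in auto)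
  ultimately show ?case by (simp add: abs_le_iff)
qed

subsection \<open>Periodic primitives\<close>

lemma antiderivative_UNIV:
  fixes u :: "real \<Rightarrow> real"
  assumes "continuous_on UNIV u"
  shows "\<exists>U. \<forall>x. (U has_real_derivative u x) (at x)"
proof -
  have "\<exists>U. \<forall>x::real. - \<infinity> < ereal x \<longrightarrow> ereal x < \<infinity> \<longrightarrow> (U has_vector_derivative u x) (at x)"
    using assms by (intro einterval_antiderivative) (auto simp: continuous_on_eq_continuous_at)
  then show ?thesis by (simp add: has_real_derivative_iff_has_vector_derivative)
qed

lemma has_integral_DERIV:
  fixes U u :: "real \<Rightarrow> real"
  assumes "\<And>x. (U has_real_derivative u x) (at x)" and "a \<le> b"
  shows "(u has_integral (U b - U a)) {a..b}"
  using assms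
  by (intro fundamental_theorem_of_calculus)
     (auto simp flip: has_real_derivative_iff_has_vector_derivative intro: DERIV_subset)

lemma periodic_antiderivative:
  fixes u U :: "real \<Rightarrow> real"
  assumes "periodic_fun_simple u p" and U: "\<And>x. (U has_real_derivative u x) (at x)"
    and "p \<ge> 0" "integral {a..a + p} u = 0"
  shows "periodic_fun_simple U p"
proof
  interpret u: periodic_fun_simple u p by fact
  fix x
  have "((\<lambda>x. U (x + p) - U x) has_real_derivative 0) (at x)" for x
    using DERIV_diff[OF DERIV_shift[THEN iffD1, OF U[of "x + p"]] U[of x]]
    by (simp add: u.plus_period)
  then have "U (x + p) - U x = U (a + p) - U a" using DERIV_isconst_all by blast
  also have "\<dots> = 0"
    using has_integral_DERIV[OF U, of a "a + p"] assms(3,4) by (simp add: has_integral_iff)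
  finally show "U (x + p) = U x" by simp
qed

lemma abs_diff_le_integral_abs_DERIV:
  fixes u U :: "real \<Rightarrow> real"
  assumes U: "\<And>x. (U has_real_derivative u x) (at x)" and u: "continuous_on UNIV u"
    and "x \<in> {a..b}" "y \<in> {a..b}"
  shows "\<bar>U x - U y\<bar> \<le> integral {a..b} (\<lambda>t. \<bar>u t\<bar>)"
  using assms(3,4)
proof (induction x y rule: linorder_wlog)
  case (le x y)
  have int: "u integrable_on {c..d}" "(\<lambda>t. \<bar>u t\<bar>) integrable_on {c..d}" for c d
    by (auto intro!: integrable_continuous_real continuous_on_rabs
        intro: continuous_on_subset[OF u])
  have "\<bar>U x - U y\<bar> = \<bar>integral {x..y} u\<bar>"
    using has_integral_DERIV[OF U \<open>x \<le> y\<close>] by (simp add: has_integral_iff)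
  also have "\<dots> \<le> integral {x..y} (\<lambda>t. \<bar>u t\<bar>)"
    using integral_norm_bound_integral[OF int, of x y] by simp
  also have "\<dots> \<le> integral {a..b} (\<lambda>t. \<bar>u t\<bar>)"
    using le by (intro integral_subset_le int) auto
  finally show ?case .
qed (simp add: abs_minus_commute)

lemma abs_le_of_integral_eq_0:
  fixes U :: "real \<Rightarrow> real"
  assumes U: "continuous_on {a..b} U" and "a < b" and "integral {a..b} U = 0" and "x \<in> {a..b}"
    and osc: "\<And>y. y \<in> {a..b} \<Longrightarrow> \<bar>U x - U y\<bar> \<le> M"
  shows "\<bar>U x\<bar> \<le> M"
proof -
  have "(b - a) * U x = integral {a..b} (\<lambda>y. U x - U y)"
    using assms(2,3) U by (subst integral_diff) (auto intro: integrable_continuous_real)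
  also have "\<bar>\<dots>\<bar> \<le> integral {a..b} (\<lambda>y. M)"
    by (rule integral_norm_bound_integral[where 'a = real, unfolded real_norm_def])
       (auto intro!: integrable_continuous_real continuous_intros U osc)
  finally have "(b - a) * \<bar>U x\<bar> \<le> (b - a) * M" using assms(2) by (simp add: abs_mult)
  then show ?thesis using assms(2) by simp
qed

lemma periodic_cell_representative:
  fixes u :: "real \<Rightarrow> 'a"
  assumes "periodic_fun_simple u p" "p > 0"
  shows "\<exists>y\<in>{a..a + p}. u y = u x"
proof -
  interpret periodic_fun_simple u p by fact
  let ?y = "a + frac ((x - a) / p) * p"
  have "x = ?y + of_int \<lfloor>(x - a) / p\<rfloor> * p"
    using assms(2) by (simp add: frac_def field_simps)
  then have "u ?y = u x" using plus_of_int by metis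
  moreover have "?y \<in> {a..a + p}"
    using assms(2) frac_lt_1[of "(x - a) / p"] by (simp add: mult_le_cancel_right1 less_imp_le)
  ultimately show ?thesis by blast
qed

lemma periodic_primitive_exists:
  fixes u :: "real \<Rightarrow> real"
  assumes u: "continuous_on UNIV u" "periodic_fun_simple u p" and p: "p > 0"
    and zero: "integral {a..a + p} u = 0"
  shows "\<exists>U. (\<forall>x. (U has_real_derivative u x) (at x)) \<and> periodic_fun_simple U p \<and>
    integral {a..a + p} U = 0 \<and> (\<forall>x. \<bar>U x\<bar> \<le> integral {a..a + p} (\<lambda>t. \<bar>u t\<bar>))"
proof -
  obtain F where F: "\<And>x. (F has_real_derivative u x) (at x)"
    using antiderivative_UNIV[OF u(1)] by auto
  define U where "U x = F x - integral {a..a + p} F / p" for x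
  have U: "(U has_real_derivative u x) (at x)" for x
    unfolding U_def using DERIV_diff[OF F DERIV_const] by simp
  have cont: "continuous_on A F" "continuous_on A U" for A
    by (auto intro: continuous_at_imp_continuous_on DERIV_isCont[OF F] DERIV_isCont[OF U])
  have mean_zero: "integral {a..a + p} U = 0"
    unfolding U_def using p by (subst integral_diff) (auto intro!: integrable_continuous_real cont)
  have periodic: "periodic_fun_simple U p"
    using periodic_antiderivative[OF u(2) U _ zero] p by simp
  have "\<bar>U x\<bar> \<le> integral {a..a + p} (\<lambda>t. \<bar>u t\<bar>)" for x
  proof -
    obtain y where y: "y \<in> {a..a + p}" "U y = U x"
      using periodic_cell_representative[OF periodic p] by blast
    have "\<bar>U y\<bar> \<le> integral {a..a + p} (\<lambda>t. \<bar>u t\<bar>)"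
      using p by (intro abs_le_of_integral_eq_0[OF cont(2) _ mean_zero y(1)]
          abs_diff_le_integral_abs_DERIV[OF U u(1) y(1)]) auto
    with y(2) show ?thesis by simp
  qed
  with U periodic mean_zero show ?thesis by blast
qed

lemma smooth_periodic_primitive_exists:
  fixes u :: "real \<Rightarrow> real"
  assumes "smooth_fun u" "periodic_fun_simple u p" "p > 0" "integral {a..a + p} u = 0"
  shows "\<exists>U. smooth_fun U \<and> deriv U = u \<and> periodic_fun_simple U p \<and>
    integral {a..a + p} U = 0 \<and> (\<forall>x. \<bar>U x\<bar> \<le> integral {a..a + p} (\<lambda>t. \<bar>u t\<bar>))"
proof -
  obtain U where U: "\<And>x. (U has_real_derivative u x) (at x)"
    and "periodic_fun_simple U p" "integral {a..a + p} U = 0"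
      "\<forall>x. \<bar>U x\<bar> \<le> integral {a..a + p} (\<lambda>t. \<bar>u t\<bar>)"
    using periodic_primitive_exists[OF smooth_fun_continuous_on[OF assms(1)] assms(2-4)] by blast
  moreover have "deriv U = u" by (rule ext) (rule DERIV_imp_deriv[OF U])
  moreover have "smooth_fun U" by (rule smooth_fun_antiderivative[OF assms(1) U])
  ultimately show ?thesis by blast
qed

lemma smooth_periodic_iterated_primitive_exists:
  fixes u :: "real \<Rightarrow> real"
  assumes "smooth_fun u" "periodic_fun_simple u p" "integral {a..a + p} u = 0" and p: "p > 0"
  shows "\<exists>\<Phi>. smooth_fun \<Phi> \<and> (deriv ^^ Suc k) \<Phi> = u \<and>
    (\<forall>x. \<bar>\<Phi> x\<bar> \<le> p ^ k * integral {a..a + p} (\<lambda>t. \<bar>u t\<bar>))"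
  using assms(1-3)
proof (induction k arbitrary: u)
  case 0
  then show ?case using smooth_periodic_primitive_exists[OF 0(1,2) p 0(3)] by auto
next
  case (Suc k)
  let ?M = "integral {a..a + p} (\<lambda>t. \<bar>u t\<bar>)"
  obtain U where U: "smooth_fun U" "periodic_fun_simple U p" "integral {a..a + p} U = 0"
    and deriv: "deriv U = u" and bound: "\<And>x. \<bar>U x\<bar> \<le> ?M"
    using smooth_periodic_primitive_exists[OF Suc.prems(1,2) p Suc.prems(3)] by blast
  obtain \<Phi> where \<Phi>: "smooth_fun \<Phi>" "(deriv ^^ Suc k) \<Phi> = U"
    "\<And>x. \<bar>\<Phi> x\<bar> \<le> p ^ k * integral {a..a + p} (\<lambda>t. \<bar>U t\<bar>)"
    using Suc.IH[OF U] by blast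
  have "integral {a..a + p} (\<lambda>t. \<bar>U t\<bar>) \<le> integral {a..a + p} (\<lambda>t. ?M)"
    by (intro integral_le integrable_continuous_real continuous_on_rabs smooth_fun_continuous_on
        U continuous_on_const bound)
  also have "\<dots> = p * ?M" using p by simp
  finally have "p ^ k * integral {a..a + p} (\<lambda>t. \<bar>U t\<bar>) \<le> p ^ Suc k * ?M"
    using p by (simp add: mult.assoc mult_left_mono mult.left_commute)
  then have "\<bar>\<Phi> x\<bar> \<le> p ^ Suc k * ?M" for x using \<Phi>(3) by (rule order_trans[rotated])
  moreover have "(deriv ^^ Suc (Suc k)) \<Phi> = u"
    using \<Phi>(2) deriv by (simp only: funpow.simps(2)[of "Suc k"] o_apply)
  ultimately show ?case using \<Phi>(1) by blast
qed

subsection \<open>Smooth approximations of the Dirac comb\<close>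

definition periodic_bump :: "real \<Rightarrow> real \<Rightarrow> real \<Rightarrow> real \<Rightarrow> real" where
  "periodic_bump p c \<delta> x = flat_exp (cos (2 * pi / p * (x - c)) - cos (2 * pi / p * \<delta>))"

lemma smooth_fun_periodic_bump: "smooth_fun (periodic_bump p c \<delta>)"
proof -
  have "smooth_fun (\<lambda>x. 2 * pi / p * (x - c))"
    using smooth_fun_affine[of "2 * pi / p" "- (2 * pi / p * c)"] by (simp add: right_diff_distrib)
  then show ?thesis
    unfolding periodic_bump_def[abs_def]
    by (intro smooth_fun_compose[OF smooth_fun_flat_exp] smooth_fun_diff
        smooth_fun_compose[OF smooth_fun_cos] smooth_fun_const)
qed

lemma periodic_bump_nonneg [simp]: "periodic_bump p c \<delta> x \<ge> 0"
  by (simp add: periodic_bump_def flat_exp_nonneg)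

lemma periodic_bump_periodic:
  assumes "p > 0"
  shows "periodic_fun_simple (periodic_bump p c \<delta>) p"
proof
  fix x
  have "2 * pi / p * (x + p - c) = 2 * pi / p * (x - c) + 2 * pi"
    using assms by (simp add: field_simps)
  then show "periodic_bump p c \<delta> (x + p) = periodic_bump p c \<delta> x"
    by (simp only: periodic_bump_def cos_periodic)
qed

lemma periodic_bump_eq_0:
  assumes "0 < \<delta>" "\<delta> \<le> \<bar>x - c\<bar>" "\<bar>x - c\<bar> \<le> p/2"
  shows "periodic_bump p c \<delta> x = 0"
proof -
  have p: "p > 0" using assms by simp
  then have "cos (2 * pi / p * (x - c)) = cos (2 * pi / p * \<bar>x - c\<bar>)"
    using cos_abs_real[of "2 * pi / p * (x - c)"] by (simp add: abs_mult)
  also have "\<dots> \<le> cos (2 * pi / p * \<delta>)"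
    using assms p by (intro cos_monotone_0_pi_le) (auto simp: field_simps)
  finally show ?thesis by (simp add: periodic_bump_def flat_exp_def)
qed

lemma integral_periodic_bump_pos:
  assumes "0 < \<delta>" "\<delta> < p/2"
  shows "integral {c - p/2..c + p/2} (periodic_bump p c \<delta>) > 0"
proof -
  have p: "p > 0" using assms by simp
  have "cos (2 * pi / p * \<delta>) < cos 0"
    using assms p by (intro cos_monotone_0_pi) (auto simp: field_simps)
  then have "periodic_bump p c \<delta> c \<noteq> 0" by (simp add: periodic_bump_def flat_exp_def)
  moreover have cont: "continuous_on A (periodic_bump p c \<delta>)" for A
    by (rule smooth_fun_continuous_on[OF smooth_fun_periodic_bump])
  ultimately have "integral {c - p/2..c + p/2} (periodic_bump p c \<delta>) \<noteq> 0"
    using p integral_eq_0_iff[OF cont, of "c - p/2" "c + p/2"] by (auto dest!: bspec[of _ _ c])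
  moreover have "integral {c - p/2..c + p/2} (periodic_bump p c \<delta>) \<ge> 0"
    by (intro integral_nonneg integrable_continuous_real cont) simp
  ultimately show ?thesis by simp
qed

text \<open>Smooth approximations of \<open>p \<Sum>\<^sub>k \<delta>(x - c - k p)\<close>, concentrated within \<open>\<delta>\<close> of the nodes.\<close>
definition comb_kernel :: "real \<Rightarrow> real \<Rightarrow> real \<Rightarrow> (real \<Rightarrow> real) \<Rightarrow> bool" where
  "comb_kernel p c \<delta> q \<longleftrightarrow> smooth_fun q \<and> periodic_fun_simple q p \<and> (\<forall>x. q x \<ge> 0) \<and>
     integral {c - p/2..c + p/2} q = p \<and> (\<forall>x. \<delta> \<le> \<bar>x - c\<bar> \<longrightarrow> \<bar>x - c\<bar> \<le> p/2 \<longrightarrow> q x = 0)"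

lemma comb_kernel_exists:
  assumes "0 < \<delta>" "\<delta> < p/2"
  shows "\<exists>q. comb_kernel p c \<delta> q"
proof -
  define m where "m = p / integral {c - p/2..c + p/2} (periodic_bump p c \<delta>)"
  have p: "p > 0" using assms by simp
  have m: "m > 0" "m * integral {c - p/2..c + p/2} (periodic_bump p c \<delta>) = p"
    using p integral_periodic_bump_pos[OF assms, of c] by (simp_all add: m_def)
  interpret periodic_fun_simple "periodic_bump p c \<delta>" p
    by (rule periodic_bump_periodic[OF p])
  have "periodic_fun_simple (\<lambda>x. m * periodic_bump p c \<delta> x) p"
    by unfold_locales (simp add: plus_period)
  moreover have "smooth_fun (\<lambda>x. m * periodic_bump p c \<delta> x)"
    by (intro smooth_fun_mult smooth_fun_const smooth_fun_periodic_bump)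
  ultimately have "comb_kernel p c \<delta> (\<lambda>x. m * periodic_bump p c \<delta> x)"
    using m assms(1) by (simp add: comb_kernel_def periodic_bump_eq_0)
  then show ?thesis by blast
qed

lemma comb_kernel_shift:
  assumes "comb_kernel p c \<delta> q"
  shows "comb_kernel p (c + real i * p) \<delta> q"
proof -
  interpret q: periodic_fun_simple q p using assms by (simp add: comb_kernel_def)
  have "q \<circ> (+) (real i * p) = q" by (auto simp: q.plus_of_nat add.commute)
  then have "integral {c + real i * p - p/2..c + real i * p + p/2} q
      = integral {c - p/2..c + p/2} q"
    using integral_shift_Icc_real[of "c - p/2" "c + p/2" q "real i * p"]
    by (simp add: algebra_simps)
  moreover have "q x = 0" if "\<delta> \<le> \<bar>x - (c + real i * p)\<bar>" "\<bar>x - (c + real i * p)\<bar> \<le> p/2" for x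
  proof -
    have "q (x - real i * p) = 0"
      using assms that by (simp add: comb_kernel_def algebra_simps)
    then show ?thesis by (simp add: q.minus_of_nat)
  qed
  ultimately show ?thesis using assms by (simp add: comb_kernel_def)
qed

lemma comb_kernel_cell_quadrature:
  assumes q: "comb_kernel p c \<delta> q" and F: "continuous_on UNIV F"
    and osc: "\<And>x. \<bar>x - c\<bar> < \<delta> \<Longrightarrow> \<bar>F x - F c\<bar> \<le> e"
  shows "\<bar>integral {c - p/2..c + p/2} (\<lambda>x. F x * q x) - p * F c\<bar> \<le> p * e"
proof -
  let ?I = "{c - p/2..c + p/2}"
  have cont: "continuous_on A F" "continuous_on A q" for A
    using q F by (auto simp: comb_kernel_def intro: smooth_fun_continuous_on continuous_on_subset)
  have mean: "integral ?I (\<lambda>x. d * q x) = p * d" for d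
    using q by (simp add: comb_kernel_def)
  have "integral ?I (\<lambda>x. F x * q x) - p * F c = integral ?I (\<lambda>x. F x * q x - F c * q x)"
    unfolding mean[symmetric]
    by (intro integral_diff[symmetric] integrable_continuous_real continuous_on_mult cont
        continuous_on_const)
  also have "\<bar>\<dots>\<bar> \<le> integral ?I (\<lambda>x. e * q x)"
  proof (rule integral_norm_bound_integral[where 'a = real, unfolded real_norm_def])
    fix x assume x: "x \<in> ?I"
    show "\<bar>F x * q x - F c * q x\<bar> \<le> e * q x"
    proof (cases "\<bar>x - c\<bar> < \<delta>")
      case True
      then show ?thesis
        using mult_right_mono[OF osc[OF True], of "q x"] q
        by (simp add: comb_kernel_def abs_mult flip: left_diff_distrib)
    next
      case False
      have "\<bar>x - c\<bar> \<le> p/2" using x unfolding abs_le_iff by auto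
      with False q have "q x = 0" by (simp add: comb_kernel_def)
      then show ?thesis by simp
    qed
  qed (intro integrable_continuous_real continuous_on_diff continuous_on_mult cont
      continuous_on_const)+
  also have "\<dots> = p * e" by (rule mean)
  finally show ?thesis .
qed

lemma integral_combine_cells:
  fixes w :: "real \<Rightarrow> real"
  assumes "continuous_on UNIV w" "p \<ge> 0"
  shows "integral {a..a + real N * p} w = (\<Sum>i<N. integral {a + real i * p..a + real (Suc i) * p} w)"
proof (induction N)
  case (Suc N)
  have "integral {a..a + real (Suc N) * p} w
      = integral {a..a + real N * p} w + integral {a + real N * p..a + real (Suc N) * p} w"
    using assms
    by (intro Henstock_Kurzweil_Integration.integral_combine[symmetric] integrable_continuous_real)
      (auto intro: continuous_on_subset mult_right_mono)
  with Suc show ?case by simp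
qed simp

lemma comb_kernel_quadrature:
  assumes q: "comb_kernel p c \<delta> q" and F: "continuous_on UNIV F" and p: "p \<ge> 0"
    and osc: "\<And>i x. i < N \<Longrightarrow> \<bar>x - (c + real i * p)\<bar> < \<delta> \<Longrightarrow> \<bar>F x - F (c + real i * p)\<bar> \<le> e"
  shows "\<bar>integral {c - p/2..c - p/2 + real N * p} (\<lambda>x. F x * q x)
      - p * (\<Sum>i<N. F (c + real i * p))\<bar> \<le> real N * (p * e)"
proof -
  let ?cell = "\<lambda>i. {c + real i * p - p/2..c + real i * p + p/2}"
  have "continuous_on UNIV (\<lambda>x. F x * q x)"
    using q by (intro continuous_on_mult F smooth_fun_continuous_on) (simp add: comb_kernel_def)
  from integral_combine_cells[OF this p, of "c - p/2" N]
  have "integral {c - p/2..c - p/2 + real N * p} (\<lambda>x. F x * q x)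
      = (\<Sum>i<N. integral (?cell i) (\<lambda>x. F x * q x))"
    by (simp add: algebra_simps)
  then have "\<bar>integral {c - p/2..c - p/2 + real N * p} (\<lambda>x. F x * q x)
      - p * (\<Sum>i<N. F (c + real i * p))\<bar>
      = \<bar>\<Sum>i<N. integral (?cell i) (\<lambda>x. F x * q x) - p * F (c + real i * p)\<bar>"
    by (simp add: sum_subtractf sum_distrib_left)
  also have "\<dots> \<le> (\<Sum>i<N. p * e)"
    using osc comb_kernel_cell_quadrature[OF comb_kernel_shift[OF q] F]
    by (intro order_trans[OF sum_abs] sum_mono) auto
  finally show ?thesis by simp
qed

lemma eventually_small_oscillation:
  fixes F :: "real \<Rightarrow> real"
  assumes "isCont F z" "e > 0"
  shows "\<forall>\<^sub>F \<delta> in at_right 0. \<forall>x. \<bar>x - z\<bar> < \<delta> \<longrightarrow> \<bar>F x - F z\<bar> < e"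
proof -
  obtain d where "d > 0" "\<And>x. \<bar>x - z\<bar> < d \<Longrightarrow> \<bar>F x - F z\<bar> < e"
    using assms unfolding continuous_at_eps_delta dist_real_def by blast
  then show ?thesis
    unfolding eventually_at_right_field by (meson less_trans)
qed

lemma comb_kernel_approximates_sum:
  fixes F :: "real \<Rightarrow> real"
  assumes F: "continuous_on UNIV F" and p: "p > 0" and "\<eta> > 0"
  shows "\<exists>\<delta> q. comb_kernel p c \<delta> q \<and>
    \<bar>integral {c - p/2..c - p/2 + real N * p} (\<lambda>x. F x * q x) - p * (\<Sum>i<N. F (c + real i * p))\<bar> \<le> \<eta>"
proof -
  define e where "e = \<eta> / (real N * p + 1)"
  have "real N * p \<ge> 0" using p by simp
  then have e: "e > 0" "real N * (p * e) \<le> \<eta>"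
    using \<open>\<eta> > 0\<close> by (auto simp: e_def field_simps)
  have "\<forall>\<^sub>F \<delta> in at_right 0. \<forall>i\<in>{..<N}. \<forall>x.
      \<bar>x - (c + real i * p)\<bar> < \<delta> \<longrightarrow> \<bar>F x - F (c + real i * p)\<bar> < e"
    using F e(1)
    by (intro eventually_ball_finite ballI eventually_small_oscillation)
       (auto simp: continuous_on_eq_continuous_at)
  moreover have "\<forall>\<^sub>F \<delta> in at_right (0::real). \<delta> \<in> {0<..<p/2}"
    using p by (intro eventually_at_right_real) simp
  ultimately obtain \<delta> where "\<delta> \<in> {0<..<p/2}" and "\<forall>i\<in>{..<N}. \<forall>x.
      \<bar>x - (c + real i * p)\<bar> < \<delta> \<longrightarrow> \<bar>F x - F (c + real i * p)\<bar> < e"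
    using eventually_happens'[OF trivial_limit_at_right_real eventually_conj] by blast
  then have \<delta>: "0 < \<delta>" "\<delta> < p/2"
    and osc: "\<And>i x. i < N \<Longrightarrow> \<bar>x - (c + real i * p)\<bar> < \<delta> \<Longrightarrow> \<bar>F x - F (c + real i * p)\<bar> \<le> e"
    by (auto simp: less_imp_le)
  obtain q where q: "comb_kernel p c \<delta> q" using comb_kernel_exists[OF \<delta>] by blast
  with comb_kernel_quadrature[OF q F less_imp_le[OF p] osc] e(2) show ?thesis
    by (meson order_trans)
qed

lemma comb_kernel_iterated_primitive_exists:
  assumes q: "comb_kernel p c \<delta> q" and p: "p > 0" and "k \<ge> 1"
  shows "\<exists>\<Phi>. smooth_fun \<Phi> \<and> (deriv ^^ k) \<Phi> = (\<lambda>x. 1 - q x) \<and> (\<forall>x. \<bar>\<Phi> x\<bar> \<le> 2 * p ^ k)"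
proof -
  let ?I = "{c - p/2..c + p/2}"
  have right_end: "c - p/2 + p = c + p/2" by simp
  obtain j where k: "k = Suc j" using \<open>k \<ge> 1\<close> by (cases k) auto
  have nonneg: "\<And>x. q x \<ge> 0" and mean: "integral ?I q = p" and smooth: "smooth_fun q"
    using q by (auto simp: comb_kernel_def)
  have int: "q integrable_on ?I"
    by (intro integrable_continuous_real smooth_fun_continuous_on smooth)
  have "integral ?I (\<lambda>x. 1 - q x) = 0" using p mean int by (subst integral_diff) auto
  moreover have "periodic_fun_simple (\<lambda>x. 1 - q x) p"
    using q by (simp add: comb_kernel_def periodic_fun_simple_def)
  moreover have "smooth_fun (\<lambda>x. 1 - q x)" by (intro smooth_fun_diff smooth smooth_fun_const)
  ultimately obtain \<Phi> where \<Phi>: "smooth_fun \<Phi>" "(deriv ^^ k) \<Phi> = (\<lambda>x. 1 - q x)"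
    "\<And>x. \<bar>\<Phi> x\<bar> \<le> p ^ j * integral ?I (\<lambda>x. \<bar>1 - q x\<bar>)"
    using smooth_periodic_iterated_primitive_exists[of "\<lambda>x. 1 - q x" p "c - p/2" j] p
    unfolding right_end k by blast
  have "integral ?I (\<lambda>x. \<bar>1 - q x\<bar>) \<le> integral ?I (\<lambda>x. 1 + q x)"
  proof (rule integral_le)
    show "\<bar>1 - q x\<bar> \<le> 1 + q x" for x using nonneg[of x] by (simp add: abs_le_iff)
  qed (intro integrable_continuous_real continuous_intros smooth_fun_continuous_on smooth)+
  also have "\<dots> = 2 * p" using p mean int by (subst integral_add) auto
  finally have "p ^ j * integral ?I (\<lambda>x. \<bar>1 - q x\<bar>) \<le> 2 * p ^ k" using p by (simp add: k)
  then have "\<bar>\<Phi> x\<bar> \<le> 2 * p ^ k" for x using \<Phi>(3) by (rule order_trans[rotated])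
  with \<Phi>(1,2) show ?thesis by blast
qed

lemma lborel_integral_eq_integral_Icc:
  fixes w :: "real \<Rightarrow> real"
  assumes "continuous_on UNIV w" "\<And>x. x \<notin> {a..b} \<Longrightarrow> w x = 0"
  shows "integral\<^sup>L lborel w = integral {a..b} w"
proof -
  have "indicator {a..b} x *\<^sub>R w x = w x" for x
    using assms(2)[of x] by (cases "x \<in> {a..b}") auto
  then have "(\<lambda>x. indicator {a..b} x *\<^sub>R w x) = w" by blast
  moreover have "set_integrable lborel {a..b} w"
    by (intro borel_integrable_atLeastAtMost' continuous_on_subset[OF assms(1)]) simp
  ultimately show ?thesis
    using set_borel_integral_eq_integral(2)[of "{a..b}" w] by (simp add: set_lebesgue_integral_def)
qed

subsection \<open>The trapezoidal rule for compactly supported weights\<close>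

lemma sobolev_H_comb_kernel_bound:
  assumes sobolev: "sobolev_H \<alpha> f g" and \<alpha>: "\<alpha> \<ge> 1" and \<psi>: "test_fun \<psi>"
    and \<beta>: "\<beta> > 1/2" and p: "p > 0" and jet: "\<And>x. jet_norm \<alpha> \<psi> x \<le> K * gauss_weight \<beta> x"
    and q: "comb_kernel p c \<delta> q"
  shows "\<bar>\<integral>x. f x * \<psi> x * (1 - q x) \<partial>lborel\<bar>
      \<le> 2 ^ (\<alpha> + 1) * p ^ \<alpha> * K * gauss_dual_norm \<beta> * sobolev_norm \<alpha> g"
proof -
  obtain \<Phi> where \<Phi>: "smooth_fun \<Phi>" "(deriv ^^ \<alpha>) \<Phi> = (\<lambda>x. 1 - q x)"
    and \<Phi>_le: "\<And>x. \<bar>\<Phi> x\<bar> \<le> 2 * p ^ \<alpha>"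
    using comb_kernel_iterated_primitive_exists[OF q p \<alpha>] by blast
  have "\<bar>\<integral>x. g 0 x * (\<psi> x * (deriv ^^ \<alpha>) \<Phi> x) \<partial>lborel\<bar>
      \<le> 2 ^ \<alpha> * (2 * p ^ \<alpha> * K * gauss_dual_norm \<beta> * sobolev_norm \<alpha> g)"
  proof (rule sobolev_H_pairing_higher_deriv_bound[OF sobolev \<beta> _ \<psi> \<Phi>(1)])
    fix x
    have "jet_norm \<alpha> \<psi> x * \<bar>\<Phi> x\<bar> \<le> (K * gauss_weight \<beta> x) * (2 * p ^ \<alpha>)"
      by (intro mult_mono jet \<Phi>_le order_trans[OF jet_norm_nonneg jet]) auto
    then show "jet_norm \<alpha> \<psi> x * \<bar>\<Phi> x\<bar> \<le> 2 * p ^ \<alpha> * K * gauss_weight \<beta> x"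
      by (simp add: mult_ac)
  qed simp
  moreover have "g 0 = f" using sobolev by (simp add: sobolev_H_def)
  ultimately show ?thesis by (simp add: \<Phi>(2) mult_ac)
qed

theorem sobolev_H_trapezoid_bound:
  assumes sobolev: "sobolev_H \<alpha> f g" and \<alpha>: "\<alpha> \<ge> 1" and f: "continuous_on UNIV f"
    and \<psi>: "test_fun \<psi>" and \<beta>: "\<beta> > 1/2" and p: "p > 0"
    and jet: "\<And>x. jet_norm \<alpha> \<psi> x \<le> K * gauss_weight \<beta> x"
    and supp: "\<And>x. x \<notin> {c - p/2..c - p/2 + real N * p} \<Longrightarrow> \<psi> x = 0"
  shows "\<bar>(\<integral>x. f x * \<psi> x \<partial>lborel) - p * (\<Sum>i<N. f (c + real i * p) * \<psi> (c + real i * p))\<bar>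
    \<le> 2 ^ (\<alpha> + 1) * p ^ \<alpha> * K * gauss_dual_norm \<beta> * sobolev_norm \<alpha> g" (is "?E \<le> ?B")
proof (rule field_le_epsilon)
  fix \<eta> :: real assume "\<eta> > 0"
  let ?I = "{c - p/2..c - p/2 + real N * p}"
  define F where "F x = f x * \<psi> x" for x
  have F: "continuous_on A F" for A
    unfolding F_def
    by (intro continuous_on_mult continuous_on_subset[OF f]
        smooth_fun_continuous_on[OF test_fun_smooth[OF \<psi>]]) simp
  obtain \<delta> q where q: "comb_kernel p c \<delta> q"
    and sum: "\<bar>integral ?I (\<lambda>x. F x * q x) - p * (\<Sum>i<N. F (c + real i * p))\<bar> \<le> \<eta>"
    using comb_kernel_approximates_sum[OF F p \<open>\<eta> > 0\<close>] by blast
  have F_mult_q: "continuous_on A (\<lambda>x. F x * q x)" for A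
    using q by (intro continuous_on_mult F smooth_fun_continuous_on) (simp add: comb_kernel_def)
  have "(\<integral>x. f x * \<psi> x * (1 - q x) \<partial>lborel) = (\<integral>x. F x - F x * q x \<partial>lborel)"
    by (simp add: F_def algebra_simps)
  also have "\<dots> = integral ?I (\<lambda>x. F x - F x * q x)"
    using supp
    by (intro lborel_integral_eq_integral_Icc continuous_on_diff F F_mult_q) (simp add: F_def)
  also have "\<dots> = integral ?I F - integral ?I (\<lambda>x. F x * q x)"
    by (intro integral_diff integrable_continuous_real F F_mult_q)
  also have "integral ?I F = (\<integral>x. F x \<partial>lborel)"
    using supp by (intro lborel_integral_eq_integral_Icc[symmetric] F) (simp add: F_def)
  finally have "\<bar>(\<integral>x. F x \<partial>lborel) - integral ?I (\<lambda>x. F x * q x)\<bar> \<le> ?B"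
    using sobolev_H_comb_kernel_bound[OF sobolev \<alpha> \<psi> \<beta> p jet q] by simp
  with sum show "?E \<le> ?B + \<eta>" unfolding F_def by linarith
qed

subsection \<open>The trapezoidal rule for the Gaussian integral\<close>

lemma gauss_cutoff_eq_0:
  "w > 0 \<Longrightarrow> a \<le> b \<Longrightarrow> x \<notin> {a - w..b + w} \<Longrightarrow> gauss_cutoff w a b x = 0"
  by (simp add: gauss_cutoff_def smooth_cutoff_eq_0)

lemma test_fun_gauss_cutoff:
  assumes "w > 0" "a \<le> b"
  shows "test_fun (gauss_cutoff w a b)"
  unfolding test_fun_iff
proof (intro conjI exI allI impI smooth_fun_gauss_cutoff gauss_cutoff_eq_0 assms)
  show "x \<notin> {a - w..b + w}" if "\<bar>x\<bar> > \<bar>a\<bar> + \<bar>b\<bar> + w" for x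
    using that by auto
qed

lemma gauss_int_cutoff_error:
  assumes f: "in_L2rho f" and \<beta>: "\<beta> > 1/2" "\<beta> + \<delta> \<le> 1" "\<delta> \<ge> 0"
    and cutoff: "w > 0" "0 \<le> R" "{- R..R} \<subseteq> {a..b}"
  shows "\<bar>gauss_int f - (\<integral>x. f x * gauss_cutoff w a b x \<partial>lborel)\<bar>
    \<le> gauss_weight \<delta> R * gauss_dual_norm \<beta> * L2rho_norm f"
proof -
  let ?\<psi> = "gauss_cutoff w a b"
  have "a \<le> b" using cutoff by auto
  then have \<psi>: "integrable lborel (\<lambda>x. f x * ?\<psi> x)"
    by (intro L2rho_test_fun_integrable f test_fun_gauss_cutoff cutoff)
  have "(\<lambda>x. gauss_rho x - ?\<psi> x) \<in> borel_measurable borel"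
    by (intro smooth_fun_borel_measurable smooth_fun_diff smooth_fun_gauss_rho
        smooth_fun_gauss_cutoff)
  note tail = L2rho_pairing_bound[OF \<beta>(1) f this abs_gauss_rho_diff_cutoff_le[OF \<beta>(2,3) cutoff]]
  have "gauss_int f = (\<integral>x. f x * ?\<psi> x + f x * (gauss_rho x - ?\<psi> x) \<partial>lborel)"
    by (simp add: gauss_int_def algebra_simps)
  also have "\<dots> = (\<integral>x. f x * ?\<psi> x \<partial>lborel) + (\<integral>x. f x * (gauss_rho x - ?\<psi> x) \<partial>lborel)"
    by (rule Bochner_Integration.integral_add[OF \<psi> tail(1)])
  finally show ?thesis using tail(2) by simp
qed

lemma trap_rule_gauss_cutoff:
  assumes "n > 0" "T \<ge> 0" "w > 0"
  defines "h \<equiv> 2 * T / real n"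
  shows "trap_rule n T (\<lambda>x. f x * gauss_rho x)
    = h * (\<Sum>i<n. f (- T + real i * h) * gauss_cutoff w (- T) (T - h) (- T + real i * h))"
proof -
  have h: "h \<ge> 0" "real n * h = 2 * T" using assms(1,2) by (simp_all add: h_def)
  have "gauss_cutoff w (- T) (T - h) (- T + real i * h) = gauss_rho (- T + real i * h)"
    if "i < n" for i
  proof (rule gauss_cutoff_eq_gauss_rho[OF assms(3)])
    have "real (Suc i) * h \<le> real n * h" using that h(1) by (intro mult_right_mono) simp_all
    then have "real i * h + h \<le> 2 * T" using h(2) by (simp add: distrib_right)
    then show "- T + real i * h \<in> {- T..T - h}" using h(1) by simp
  qed
  then show ?thesis by (simp add: trap_rule_def h_def mult.commute)
qed

lemma sobolev_H_trap_rule_cutoff_error: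
  assumes sobolev: "sobolev_H \<alpha> f g" and \<alpha>: "\<alpha> \<ge> 1" and f: "continuous_on UNIV f" and \<beta>: "\<beta> > 1/2"
    and n: "n \<ge> 2" and T: "T > 0"
  defines "h \<equiv> 2 * T / real n"
  defines "\<psi> \<equiv> gauss_cutoff (h/2) (- T) (T - h)"
  assumes jet: "\<And>x. jet_norm \<alpha> \<psi> x \<le> K * gauss_weight \<beta> x"
  shows "\<bar>(\<integral>x. f x * \<psi> x \<partial>lborel) - trap_rule n T (\<lambda>x. f x * gauss_rho x)\<bar>
    \<le> 2 ^ (\<alpha> + 1) * h ^ \<alpha> * K * gauss_dual_norm \<beta> * sobolev_norm \<alpha> g"
proof -
  have h: "h > 0" "real n * h = 2 * T" using n T by (simp_all add: h_def)
  have "2 * h \<le> real n * h" using n h(1) by (intro mult_right_mono) simp_all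
  then have "- T \<le> T - h" using h by simp
  have "trap_rule n T (\<lambda>x. f x * gauss_rho x)
      = h * (\<Sum>i<n. f (- T + real i * h) * \<psi> (- T + real i * h))"
    unfolding \<psi>_def h_def using n T by (intro trap_rule_gauss_cutoff) simp_all
  moreover have "\<psi> x = 0" if "x \<notin> {- T - h/2..- T - h/2 + real n * h}" for x
  proof -
    have "x \<notin> {- T - h/2..T - h + h/2}" using that h(2) by auto
    then show ?thesis using h(1) \<open>- T \<le> T - h\<close> by (simp add: \<psi>_def gauss_cutoff_eq_0)
  qed
  moreover have "test_fun \<psi>"
    unfolding \<psi>_def using h(1) \<open>- T \<le> T - h\<close> by (intro test_fun_gauss_cutoff) simp_all
  ultimately show ?thesis
    using sobolev_H_trapezoid_bound[OF sobolev \<alpha> f _ \<beta> h(1) jet, of "- T" n] by simp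
qed

text \<open>
  With \<open>h = 2T/n\<close>, the first term comes from moving \<open>\<alpha>\<close> derivatives, the second from the
  derivatives of the cutoff, which cost \<open>(2/h)\<^sup>\<alpha>\<close> but see only the Gaussian beyond \<open>T - h\<close>.
\<close>
definition trap_error_rate :: "real \<Rightarrow> nat \<Rightarrow> nat \<Rightarrow> real \<Rightarrow> real" where
  "trap_error_rate \<delta> \<alpha> n T = (2 * T / real n) ^ \<alpha> +
     max (2 * T / real n) 2 ^ \<alpha> * gauss_weight \<delta> (T - 2 * T / real n)"

lemma sobolev_H_gauss_trapezoid_error:
  assumes sobolev: "sobolev_H \<alpha> f g" and \<alpha>: "\<alpha> \<ge> 1" and f: "continuous_on UNIV f"
    and \<beta>: "\<beta> > 1/2" "\<beta> + \<delta> \<le> 1" "\<delta> \<ge> 0" and n: "n \<ge> 2" and T: "T > 0"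
  defines "h \<equiv> 2 * T / real n"
  defines "\<psi> \<equiv> gauss_cutoff (h/2) (- T) (T - h)"
  assumes jet: "\<And>x. jet_norm \<alpha> \<psi> x
    \<le> K * (1 + max 1 (2 / h) ^ \<alpha> * gauss_weight \<delta> (T - h)) * gauss_weight \<beta> x"
  shows "\<bar>gauss_int f - trap_rule n T (\<lambda>x. f x * gauss_rho x)\<bar>
    \<le> (2 ^ (\<alpha> + 1) * K + 1) * gauss_dual_norm \<beta> * sobolev_norm \<alpha> g * trap_error_rate \<delta> \<alpha> n T"
proof -
  let ?GS = "gauss_dual_norm \<beta> * sobolev_norm \<alpha> g" and ?r = "gauss_weight \<delta> (T - h)"
  have rate: "trap_error_rate \<delta> \<alpha> n T = h ^ \<alpha> + max h 2 ^ \<alpha> * ?r"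
    by (simp add: trap_error_rate_def h_def)
  have h: "h > 0" "h \<le> T" using n T by (simp_all add: h_def field_simps)
  have f_L2: "in_L2rho f" "L2rho_norm f \<le> sobolev_norm \<alpha> g"
    using sobolev_H_in_L2rho[OF sobolev, of 0] L2rho_norm_le_sobolev_norm[of 0 \<alpha> g] sobolev
    by (simp_all add: sobolev_H_def)
  have "\<bar>gauss_int f - (\<integral>x. f x * \<psi> x \<partial>lborel)\<bar> \<le> ?r * gauss_dual_norm \<beta> * L2rho_norm f"
    unfolding \<psi>_def using h by (intro gauss_int_cutoff_error f_L2 \<beta>) auto
  also have "\<dots> \<le> ?r * gauss_dual_norm \<beta> * sobolev_norm \<alpha> g"
    by (intro mult_left_mono f_L2) simp
  also have "\<dots> \<le> max h 2 ^ \<alpha> * (?r * ?GS)"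
    using mult_right_mono[of 1 "max h 2 ^ \<alpha>" "?r * ?GS"] by (simp add: one_le_power mult.assoc)
  also have "\<dots> \<le> ?GS * trap_error_rate \<delta> \<alpha> n T"
    using h(1) by (simp add: rate algebra_simps)
  finally have truncation: "\<bar>gauss_int f - (\<integral>x. f x * \<psi> x \<partial>lborel)\<bar>
      \<le> ?GS * trap_error_rate \<delta> \<alpha> n T" .
  have "h * max 1 (2 / h) = max h 2" using h(1) by (simp add: max_mult_distrib_left)
  then have max_power: "h ^ \<alpha> * max 1 (2 / h) ^ \<alpha> = max h 2 ^ \<alpha>"
    by (simp flip: power_mult_distrib)
  have "\<bar>(\<integral>x. f x * \<psi> x \<partial>lborel) - trap_rule n T (\<lambda>x. f x * gauss_rho x)\<bar>
      \<le> 2 ^ (\<alpha> + 1) * h ^ \<alpha> * (K * (1 + max 1 (2 / h) ^ \<alpha> * ?r)) * ?GS"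
    using sobolev_H_trap_rule_cutoff_error[OF sobolev \<alpha> f \<beta>(1) n T jet[unfolded h_def \<psi>_def]]
    unfolding h_def \<psi>_def by (simp only: mult.assoc)
  also have "\<dots> = 2 ^ (\<alpha> + 1) * K * ?GS * trap_error_rate \<delta> \<alpha> n T"
    by (simp add: rate algebra_simps flip: max_power)
  finally show ?thesis using truncation by (simp add: algebra_simps)
qed

theorem gauss_trapezoid_error:
  assumes \<alpha>: "\<alpha> \<ge> 1" and \<delta>: "0 \<le> \<delta>" "\<delta> < 1/2"
  shows "\<exists>C\<ge>0. \<forall>f g n T. continuous_on UNIV f \<longrightarrow> sobolev_H \<alpha> f g \<longrightarrow> n \<ge> 2 \<longrightarrow> T > 0 \<longrightarrow>
    \<bar>gauss_int f - trap_rule n T (\<lambda>x. f x * gauss_rho x)\<bar>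
      \<le> C * sobolev_norm \<alpha> g * trap_error_rate \<delta> \<alpha> n T"
proof -
  define \<beta> where "\<beta> = 3/4 - \<delta>/2"
  have \<beta>: "\<beta> > 1/2" "\<beta> + \<delta> < 1" using \<delta> by (simp_all add: \<beta>_def)
  obtain K where K: "K \<ge> 0" and jet: "\<And>w a b R x. w > 0 \<Longrightarrow> 0 \<le> R \<Longrightarrow> {- R..R} \<subseteq> {a..b} \<Longrightarrow>
      jet_norm \<alpha> (gauss_cutoff w a b) x
        \<le> K * (1 + max 1 (1 / w) ^ \<alpha> * gauss_weight \<delta> R) * gauss_weight \<beta> x"
    using jet_norm_gauss_cutoff_le[OF \<beta>(2) \<delta>(1), of \<alpha>] by blast
  show ?thesis
  proof (intro exI[of _ "(2 ^ (\<alpha> + 1) * K + 1) * gauss_dual_norm \<beta>"] conjI allI impI)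
    fix f g and n :: nat and T :: real
    assume prems: "continuous_on UNIV f" "sobolev_H \<alpha> f g" "n \<ge> 2" "T > 0"
    let ?h = "2 * T / real n"
    have h: "?h > 0" "?h \<le> T" using prems(3,4) by (simp_all add: field_simps)
    have "jet_norm \<alpha> (gauss_cutoff (?h/2) (- T) (T - ?h)) x
        \<le> K * (1 + max 1 (2 / ?h) ^ \<alpha> * gauss_weight \<delta> (T - ?h)) * gauss_weight \<beta> x" for x
      using jet[of "?h/2" "T - ?h" "- T" "T - ?h" x] h by simp
    then show "\<bar>gauss_int f - trap_rule n T (\<lambda>x. f x * gauss_rho x)\<bar>
        \<le> (2 ^ (\<alpha> + 1) * K + 1) * gauss_dual_norm \<beta> * sobolev_norm \<alpha> g * trap_error_rate \<delta> \<alpha> n T"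
      using \<beta> \<delta>(1) prems by (intro sobolev_H_gauss_trapezoid_error \<alpha>) simp_all
  qed (use K in simp)
qed

subsection \<open>The logarithmic truncation parameter\<close>

lemma ln_powr_le_ln_powr:
  fixes x s t :: real
  assumes "x \<ge> 2" "s \<le> t"
  shows "ln x powr s \<le> ln 2 powr (s - t) * ln x powr t"
proof -
  have ln: "ln 2 > (0::real)" "ln 2 \<le> ln x" using assms(1) by simp_all
  have "ln x powr s = ln x powr (s - t) * ln x powr t" by (simp flip: powr_add)
  also have "\<dots> \<le> ln 2 powr (s - t) * ln x powr t"
    using assms(2) ln by (intro mult_right_mono powr_mono2') auto
  finally show ?thesis .
qed

definition log_truncation :: "real \<Rightarrow> nat \<Rightarrow> real" where
  "log_truncation A n = sqrt (A * ln (real n))"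

lemma log_truncation_pos: "A > 0 \<Longrightarrow> n \<ge> 2 \<Longrightarrow> log_truncation A n > 0"
  by (simp add: log_truncation_def)

lemma ln_real_le_self: "n > 0 \<Longrightarrow> ln (real n) \<le> real n"
  using ln_le_minus_one[of "real n"] by simp

lemma log_truncation_step_power:
  assumes "n \<ge> 2"
  shows "(2 * log_truncation A n / real n) ^ \<alpha>
    = (2 * sqrt A) ^ \<alpha> * ln (real n) powr (real \<alpha>/2) / real n ^ \<alpha>"
proof -
  have "sqrt (ln (real n)) ^ \<alpha> = ln (real n) powr (real \<alpha>/2)"
    using assms by (simp add: powr_half_sqrt[symmetric] powr_powr flip: powr_realpow)
  then show ?thesis
    by (simp add: log_truncation_def real_sqrt_mult power_divide power_mult_distrib)
qed

lemma log_truncation_step_le: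
  assumes "A > 0" "n \<ge> 2"
  shows "2 * log_truncation A n / real n \<le> 2 * sqrt A"
proof -
  have "ln (real n) \<le> real n" using assms(2) by (intro ln_real_le_self) simp
  also have "\<dots> \<le> (real n)\<^sup>2" using assms(2) by (simp add: power2_eq_square)
  finally have "sqrt (ln (real n)) \<le> real n" by (intro real_le_lsqrt) auto
  then show ?thesis
    using assms by (simp add: log_truncation_def real_sqrt_mult divide_le_eq mult_left_mono)
qed

lemma gauss_weight_log_truncation_le:
  assumes "A > 0" "\<delta> \<ge> 0" "n \<ge> 2"
  defines "T \<equiv> log_truncation A n"
  shows "gauss_weight \<delta> (T - 2 * T / real n) \<le> exp (2 * \<delta> * A) * real n powr - (\<delta> * A / 2)"
proof -
  have T_square: "T\<^sup>2 = A * ln (real n)" using assms(1,3) by (simp add: T_def log_truncation_def)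
  have "ln (real n) \<le> real n" using assms(3) by (intro ln_real_le_self) simp
  then have "4 * (A * ln (real n)) / real n \<le> 4 * A"
    using assms(1,3) by (simp add: divide_le_eq mult_left_mono)
  moreover have "(T - 2 * T / real n)\<^sup>2 = T\<^sup>2 - 4 * T\<^sup>2 / real n + (2 * T / real n)\<^sup>2"
    by (simp add: power2_eq_square algebra_simps)
  ultimately have "A * ln (real n) - 4 * A \<le> (T - 2 * T / real n)\<^sup>2"
    unfolding T_square using zero_le_power2[of "2 * T / real n"] by linarith
  then have "\<delta> * (A * ln (real n) - 4 * A) \<le> \<delta> * (T - 2 * T / real n)\<^sup>2"
    using assms(2) by (rule mult_left_mono)
  then have "gauss_weight \<delta> (T - 2 * T / real n)
      \<le> exp (2 * \<delta> * A + - (\<delta> * A / 2) * ln (real n))"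
    by (simp add: gauss_weight_def algebra_simps)
  also have "\<dots> = exp (2 * \<delta> * A) * real n powr - (\<delta> * A / 2)"
    unfolding exp_add using assms(3) by (simp add: powr_def)
  finally show ?thesis .
qed

lemma trap_error_rate_log_truncation_le:
  assumes A: "A > 0" and \<delta>: "\<delta> \<ge> 0" "\<delta> * A = 2 * real \<alpha>" and s: "s \<ge> real \<alpha>/2"
  shows "\<exists>D. \<forall>n\<ge>2. trap_error_rate \<delta> \<alpha> n (log_truncation A n) \<le> D * ln (real n) powr s / real n ^ \<alpha>"
proof (intro exI allI impI)
  fix n :: nat assume n: "n \<ge> 2"
  let ?T = "log_truncation A n" and ?L = "ln (real n)"
  let ?h = "2 * ?T / real n" and ?a = "(2 * sqrt A) ^ \<alpha>"
  let ?b = "max (2 * sqrt A) 2 ^ \<alpha> * exp (4 * real \<alpha>)"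
  have "gauss_weight \<delta> (?T - ?h) \<le> exp (2 * \<delta> * A) * real n powr - (\<delta> * A / 2)"
    by (rule gauss_weight_log_truncation_le[OF A \<delta>(1) n])
  also have "\<dots> = exp (4 * real \<alpha>) * real n powr - real \<alpha>"
    using \<delta>(2) by (simp only: mult.assoc[of 2]) simp
  also have "\<dots> = exp (4 * real \<alpha>) / real n ^ \<alpha>"
    using n by (simp add: powr_minus_divide powr_realpow)
  finally have "gauss_weight \<delta> (?T - ?h) \<le> exp (4 * real \<alpha>) / real n ^ \<alpha>" .
  moreover have "max ?h 2 ^ \<alpha> \<le> max (2 * sqrt A) 2 ^ \<alpha>"
    using log_truncation_step_le[OF A n] by (intro power_mono) auto
  ultimately have "max ?h 2 ^ \<alpha> * gauss_weight \<delta> (?T - ?h)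
      \<le> max (2 * sqrt A) 2 ^ \<alpha> * (exp (4 * real \<alpha>) / real n ^ \<alpha>)"
    by (intro mult_mono) auto
  moreover have "?L powr 0 = 1" using n by simp
  ultimately have "trap_error_rate \<delta> \<alpha> n ?T
      \<le> (?a * ?L powr (real \<alpha>/2) + ?b * ?L powr 0) / real n ^ \<alpha>"
    using log_truncation_step_power[OF n, of A \<alpha>]
    by (simp add: trap_error_rate_def add_divide_distrib)
  also have "\<dots> \<le> (?a * (ln 2 powr (real \<alpha>/2 - s) * ?L powr s)
      + ?b * (ln 2 powr (0 - s) * ?L powr s)) / real n ^ \<alpha>"
    using A n s
    by (intro divide_right_mono add_mono mult_left_mono ln_powr_le_ln_powr) simp_all
  also have "\<dots> = (?a * ln 2 powr (real \<alpha>/2 - s) + ?b * ln 2 powr (0 - s)) * ?L powr s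
      / real n ^ \<alpha>"
    by (simp add: distrib_right mult.assoc)
  finally show "trap_error_rate \<delta> \<alpha> n ?T
      \<le> (?a * ln 2 powr (real \<alpha>/2 - s) + ?b * ln 2 powr (0 - s)) * ?L powr s / real n ^ \<alpha>" .
qed

theorem gauss_log_truncation_error:
  assumes "\<alpha> \<ge> 1" and \<delta>: "0 \<le> \<delta>" "\<delta> < 1/2"
    and A: "A > 0" "\<delta> * A = 2 * real \<alpha>" and s: "s \<ge> real \<alpha>/2"
  shows "\<exists>C. \<forall>f g n. continuous_on UNIV f \<longrightarrow> sobolev_H \<alpha> f g \<longrightarrow> n \<ge> 2 \<longrightarrow>
    \<bar>gauss_int f - trap_rule n (log_truncation A n) (\<lambda>x. f x * gauss_rho x)\<bar>
      \<le> C * sobolev_norm \<alpha> g * ln (real n) powr s / real n ^ \<alpha>"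
proof -
  obtain C where C: "C \<ge> 0" and error: "\<And>f g n T. continuous_on UNIV f \<Longrightarrow> sobolev_H \<alpha> f g \<Longrightarrow>
      n \<ge> 2 \<Longrightarrow> T > 0 \<Longrightarrow> \<bar>gauss_int f - trap_rule n T (\<lambda>x. f x * gauss_rho x)\<bar>
        \<le> C * sobolev_norm \<alpha> g * trap_error_rate \<delta> \<alpha> n T"
    using gauss_trapezoid_error[OF assms(1) \<delta>] by auto
  obtain D where rate: "\<And>n. n \<ge> 2 \<Longrightarrow>
      trap_error_rate \<delta> \<alpha> n (log_truncation A n) \<le> D * ln (real n) powr s / real n ^ \<alpha>"
    using trap_error_rate_log_truncation_le[OF A(1) \<delta>(1) A(2) s] by auto
  show ?thesis
  proof (intro exI[of _ "C * D"] allI impI)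
    fix f g and n :: nat
    assume prems: "continuous_on UNIV f" "sobolev_H \<alpha> f g" "n \<ge> 2"
    have "\<bar>gauss_int f - trap_rule n (log_truncation A n) (\<lambda>x. f x * gauss_rho x)\<bar>
        \<le> C * sobolev_norm \<alpha> g * trap_error_rate \<delta> \<alpha> n (log_truncation A n)"
      by (intro error prems log_truncation_pos A)
    also have "\<dots> \<le> C * sobolev_norm \<alpha> g * (D * ln (real n) powr s / real n ^ \<alpha>)"
      using C by (intro mult_left_mono rate prems) simp_all
    finally show "\<bar>gauss_int f - trap_rule n (log_truncation A n) (\<lambda>x. f x * gauss_rho x)\<bar>
        \<le> C * D * sobolev_norm \<alpha> g * ln (real n) powr s / real n ^ \<alpha>"
      by (simp add: mult_ac)
  qed
qed

theorem theorem4p5: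
  fixes \<epsilon> :: real and \<alpha> :: nat
  assumes "1/2 < \<epsilon>" and "\<epsilon> < 1" and "\<alpha> \<ge> 1"
  shows "\<exists>C. \<forall>f g (n::nat). continuous_on UNIV f \<longrightarrow> sobolev_H \<alpha> f g \<longrightarrow> n \<ge> 2 \<longrightarrow>
     \<bar>gauss_int f - trap_rule n (sqrt (2 / (1 - \<epsilon>) * real \<alpha> * ln (real n)))
                                  (\<lambda>x. f x * gauss_rho x)\<bar>
       \<le> C * sobolev_norm \<alpha> g * ln (real n) powr (real \<alpha> / 2 + 1/4) / real n ^ \<alpha>"
proof -
  have "0 \<le> 1 - \<epsilon>" "1 - \<epsilon> < 1/2" using assms(1,2) by simp_all
  moreover have "2 / (1 - \<epsilon>) * real \<alpha> > 0" "(1 - \<epsilon>) * (2 / (1 - \<epsilon>) * real \<alpha>) = 2 * real \<alpha>"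
    using assms by simp_all
  moreover have "real \<alpha> / 2 + 1/4 \<ge> real \<alpha> / 2" by simp
  ultimately show ?thesis
    by (rule gauss_log_truncation_error[OF assms(3), unfolded log_truncation_def])
qed

end
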